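(* Let $X$ be a manifold, $\xi\in\mathcal G^1_0(X)$ a generalized vector field, and $\Psi:\mathbb R\times X\to X$ a map. (i) Suppose $h$ is a complete Riemannian metric on $X$, $\xi$ is globally bounded with respect to $h$, and for each differential operator $P\in\mathcal P(X,TX)$ of first order $P\xi$ is locally of $L^\infty$-log-type and moreover locally bounded. Let $\Phi\in\mathcal G[\mathbb R\times X,X]$ be the generalized flow of $\xi$. If for all $t\in\mathbb R$, $\Phi(t,\cdot)\approx_{\mathrm f}\Psi(t,\cdot)$ (fast association), then $\Psi$ has the flow property, i.e. $\Psi(s+t,p)=\Psi(s,\Psi(t,p))$ for all $s,t\in\mathbb R$ and all $p\in X$. (ii) Suppose $\xi$ is $\mathcal G$-complete with generalized flow $\Phi$. If for each $t\in\mathbb R$, $\Phi(t,\cdot)\approx_0\Psi(t,\cdot)$ (zero-association), then $\Psi$ has the flow property.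
   Context: Manifolds are smooth, paracompact and Hausdorff. $I=(0,1]$; $O(\cdot)$ is for $\varepsilon\to0$; $K\subset\subset A$ means $K$ is a compact subset of the interior of $A$. $d_h$ is the Riemannian distance, $\|\cdot\|_h$ the fibre norm induced by a Riemannian metric $h$, $\pi_X:TX\to X$ the projection. $\mathcal P(X,TX)$ is the space of linear differential operators $\Gamma(X,TX)\to\Gamma(X,TX)$ with smooth coefficients. $\mathcal G^1_0(X)$ (generalized vector fields) is the quotient of $\{(\xi_\varepsilon)_\varepsilon\in\Gamma(X,TX)^I:\forall P\in\mathcal P(X,TX)\ \forall K\subset\subset X\ \exists N: \sup_K\|P\xi_\varepsilon\|_h=O(\varepsilon^{-N})\}$ by those of its elements with $\sup_K\|\xi_\varepsilon\|_h=O(\varepsilon^m)$ for all $K\subset\subset X$, $m\in\mathbb N$ ($h$ any Riemannian metric). Operators $P$ act on representatives. $\xi\in\mathcal G^1_0(X)$ is locally bounded (resp. locally of $L^\infty$-log-type) if for all $K\subset\subset X$ there is $C$ with $\sup_{p\in K}\|\xi_\varepsilon|_p\|_h\le C$ (resp. $\le C|\log\varepsilon|$) for small $\varepsilon$ (independent of representative and metric). $\xi$ is globally bounded with respect to $h$ if for some representative $(\xi_\varepsilon)_\varepsilon$ there is $C>0$ with $\sup_{p\in X}\|\xi_\varepsilon|_p\|_h\le C$ for all small $\varepsilon$. For manifolds $M,Y$: a net $(u_\varepsilon)_\varepsilon\in C^\infty(M,Y)^I$ is c-bounded if for all $K\subset\subset M$ there are $\varepsilon_0>0$, $K'\subset\subset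 Y$ with $u_\varepsilon(K)\subseteq K'$ for $\varepsilon<\varepsilon_0$. $\mathcal E_M[M,Y]$ is the set of c-bounded nets such that for every $k\in\mathbb N$, all charts $(V,\varphi)$ of $M$, $(W,\psi)$ of $Y$, all $L\subset\subset V$, $L'\subset\subset W$ there is $N$ with $\sup_{p\in L\cap u_\varepsilon^{-1}(L')}\|D^{(k)}(\psi\circ u_\varepsilon\circ\varphi^{-1})(\varphi(p))\|=O(\varepsilon^{-N})$. Two such nets are equivalent if (a) $\sup_{p\in K}d(u_\varepsilon(p),v_\varepsilon(p))\to0$ for all $K\subset\subset M$ ($d$ the distance of any Riemannian metric on $Y$) and (b) for all $k\in\mathbb N_0$, $m\in\mathbb N$ and all charts and $L,L'$ as before, $\sup_{p\in L\cap u_\varepsilon^{-1}(L')\cap v_\varepsilon^{-1}(L')}\|D^{(k)}(\psi\circ u_\varepsilon\circ\varphi^{-1}-\psi\circ v_\varepsilon\circ\varphi^{-1})(\varphi(p))\|=O(\varepsilon^m)$. $\mathcal G[M,Y]$ is the quotient. Hybrid space $\mathcal G^h[M,TX]$ (superscript $h$ for "hybrid"): nets $(u_\varepsilon)_\varepsilon\in C^\infty(M,TX)^I$ such that $\underline{u}_\varepsilon:=\pi_X\circ u_\varepsilon$ is c-bounded and for every $k\in\mathbb N_0$, chart $(V,\varphi)$ of $M$, vector bundle chart $(W,\Theta)$ of $TX$ (over $W\subseteq X$), $L\subset\subset V$, $L'\subset\subset W$ there is $N$ with $\|D^{(k)}(\Theta\circ u_\varepsilon\circ\varphi^{-1})(\varphi(p))\|=O(\varepsilon^{-N})$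 uniformly in $p\in L\cap\underline{u}_\varepsilon^{-1}(L')$; modulo the equivalence: $\sup_Kd_h(\underline u_\varepsilon,\underline v_\varepsilon)\to0$ for all $K\subset\subset M$, and for all $k,m$, charts and $L,L'$ as before, $\|D^{(k)}(\Theta\circ u_\varepsilon\circ\varphi^{-1}-\Theta\circ v_\varepsilon\circ\varphi^{-1})(\varphi(p))\|=O(\varepsilon^m)$ uniformly in $p\in L\cap\underline u_\varepsilon^{-1}(L')\cap\underline v_\varepsilon^{-1}(L')$. $\xi\in\mathcal G^1_0(X)$ is $\mathcal G$-complete if there is a unique $\Phi\in\mathcal G[\mathbb R\times X,X]$ (the generalized flow of $\xi$) with $\frac{d}{dt}\Phi(t,x)=\xi(\Phi(t,x))$ in $\mathcal G^h[\mathbb R\times X,TX]$, $\Phi(0,\cdot)=\mathrm{id}_X$ in $\mathcal G[X,X]$ and $\Phi(t+s,\cdot)=\Phi(t,\Phi(s,\cdot))$ in $\mathcal G[\mathbb R^2\times X,X]$ (operations defined on representatives). Under the assumptions of (i), $\xi$ is $\mathcal G$-complete. For $u=[(u_\varepsilon)_\varepsilon]\in\mathcal G[X,Y]$ and a map $v:X\to Y$, with $d_h$ the distance of any Riemannian metric on $Y$: $u\approx_{\mathrm f}v$ iff $d_h(u_\varepsilon(p),v(p))=O(\varepsilon^m)$ for all $p\in X$ and all $m\in\mathbb N$; $u\approx_0v$ iff $\sup_{p\in K}d_h(u_\varepsilon(p),v(p))\to0$ as $\varepsilon\to0$ for all $K\subset\subset X$. Both notions are independent of the representative. *)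

theory Defs
  imports "HOL-Analysis.Analysis"
begin

section \<open>Smooth maps between finite-dimensional spaces\<close>

text \<open>
  Model spaces are taken of sort \<open>{real_inner, heine_borel}\<close>, i.e. finite-dimensional Euclidean
  vector spaces. Unlike \<open>euclidean_space\<close> this sort does not exclude dimension zero.
\<close>

primrec iter_deriv :: "'e::real_normed_vector list \<Rightarrow> ('e \<Rightarrow> 'f::real_normed_vector) \<Rightarrow> 'e \<Rightarrow> 'f" where
  "iter_deriv [] f = f"
| "iter_deriv (v # vs) f = (\<lambda>x. frechet_derivative (iter_deriv vs f) (at x) v)"

text \<open>
  Meant for open \<open>S\<close>. In finite dimensions, existence and differentiability of all iterated
  directional derivatives is the same as being of class \<open>C\<close>-infinity.
\<close>

definition smooth_on :: "'e::real_normed_vector set \<Rightarrow> ('e \<Rightarrow> 'f::real_normed_vector) \<Rightarrow> bool" where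
  "smooth_on S f \<longleftrightarrow> (\<forall>vs. \<forall>x\<in>S. iter_deriv vs f differentiable (at x))"

text \<open>The operator norm of the \<open>k\<close>-linear map that is the \<open>k\<close>-th derivative of \<open>f\<close> at \<open>x\<close>.\<close>

definition deriv_norm :: "nat \<Rightarrow> ('e::real_normed_vector \<Rightarrow> 'f::real_normed_vector) \<Rightarrow> 'e \<Rightarrow> ennreal" where
  "deriv_norm k f x =
     (SUP vs\<in>{vs. length vs = k \<and> (\<forall>v\<in>set vs. norm v \<le> 1)}. ennreal (norm (iter_deriv vs f x)))"

section \<open>Manifolds\<close>

text \<open>
  A manifold is given by an atlas; its point set is the union of the chart domains and its topology
  is the one determined by the charts. Values of a chart outside its domain are irrelevant.
\<close>

type_synonym ('a, 'e) chart = "'a set \<times> ('a \<Rightarrow> 'e)"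
type_synonym ('a, 'e) atlas = "('a, 'e) chart set"

definition carrier :: "('a, 'e) atlas \<Rightarrow> 'a set" where
  "carrier A = (\<Union>(V, \<phi>)\<in>A. V)"

definition mtop :: "('a, 'e::topological_space) atlas \<Rightarrow> 'a topology" where
  "mtop A = topology (\<lambda>U. U \<subseteq> carrier A \<and> (\<forall>(V, \<phi>)\<in>A. open (\<phi> ` (U \<inter> V))))"

definition compatible :: "('a, 'e::real_normed_vector) chart \<Rightarrow> ('a, 'e) chart \<Rightarrow> bool" where
  "compatible c d = (case (c, d) of ((V, \<phi>), (W, \<psi>)) \<Rightarrow>
     open (\<phi> ` (V \<inter> W)) \<and> open (\<psi> ` (V \<inter> W)) \<and>
     smooth_on (\<phi> ` (V \<inter> W)) (\<psi> \<circ> inv_into V \<phi>) \<and>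
     smooth_on (\<psi> ` (V \<inter> W)) (\<phi> \<circ> inv_into W \<psi>))"

text \<open>The maximal atlas.\<close>

definition charts :: "('a, 'e::real_normed_vector) atlas \<Rightarrow> ('a, 'e) atlas" where
  "charts A = {(V, \<phi>). V \<subseteq> carrier A \<and> inj_on \<phi> V \<and> open (\<phi> ` V) \<and> (\<forall>d\<in>A. compatible (V, \<phi>) d)}"

definition paracompact_space :: "'a topology \<Rightarrow> bool" where
  "paracompact_space T \<longleftrightarrow>
     (\<forall>\<U>. (\<forall>U\<in>\<U>. openin T U) \<and> \<Union>\<U> = topspace T \<longrightarrow>
       (\<exists>\<V>. (\<forall>V\<in>\<V>. openin T V \<and> (\<exists>U\<in>\<U>. V \<subseteq> U)) \<and> \<Union>\<V> = topspace T \<and> locally_finite_in T \<V>))"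

definition smooth_manifold :: "('a, 'e::{real_inner,heine_borel}) atlas \<Rightarrow> bool" where
  "smooth_manifold A \<longleftrightarrow> A \<subseteq> charts A \<and> Hausdorff_space (mtop A) \<and> paracompact_space (mtop A)"

lemma openin_mtop:
  assumes "A \<subseteq> charts A"
  shows "openin (mtop A) U \<longleftrightarrow> U \<subseteq> carrier A \<and> (\<forall>(V, \<phi>)\<in>A. open (\<phi> ` (U \<inter> V)))"
proof -
  have inj: "inj_on \<phi> V" if "(V, \<phi>) \<in> A" for V \<phi>
    using assms that by (auto simp: charts_def)
  have "istopology (\<lambda>U. U \<subseteq> carrier A \<and> (\<forall>(V, \<phi>)\<in>A. open (\<phi> ` (U \<inter> V))))"
    unfolding istopology_def
  proof (intro conjI allI impI; clarify?)
    fix S T V \<phi>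
    assume S: "\<forall>(V, \<phi>)\<in>A. open (\<phi> ` (S \<inter> V))" and T: "\<forall>(V, \<phi>)\<in>A. open (\<phi> ` (T \<inter> V))"
      and c: "(V, \<phi>) \<in> A"
    have "\<phi> ` (S \<inter> T \<inter> V) = \<phi> ` (S \<inter> V) \<inter> \<phi> ` (T \<inter> V)"
      using inj[OF c] by (auto simp: inj_on_def)
    then show "open (\<phi> ` (S \<inter> T \<inter> V))" using S T c by auto
  next
    fix \<K> V \<phi>
    assume K: "\<forall>K\<in>\<K>. K \<subseteq> carrier A \<and> (\<forall>(V, \<phi>)\<in>A. open (\<phi> ` (K \<inter> V)))" and c: "(V, \<phi>) \<in> A"
    have "\<phi> ` (\<Union>\<K> \<inter> V) = (\<Union>K\<in>\<K>. \<phi> ` (K \<inter> V))" by auto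
    moreover have "open (\<Union>K\<in>\<K>. \<phi> ` (K \<inter> V))" using K c by (intro open_UN) auto
    ultimately show "open (\<phi> ` (\<Union>\<K> \<inter> V))" by simp
  qed auto
  then show ?thesis by (simp add: mtop_def)
qed

lemma topspace_mtop:
  assumes "A \<subseteq> charts A"
  shows "topspace (mtop A) = carrier A"
proof
  show "topspace (mtop A) \<subseteq> carrier A"
    using openin_mtop[OF assms, of "topspace (mtop A)"] by simp
  have "carrier A \<inter> V = V" if "(V, \<phi>) \<in> A" for V \<phi>
    using that by (auto simp: carrier_def)
  then have "openin (mtop A) (carrier A)"
    using assms by (auto simp: openin_mtop charts_def)
  then show "carrier A \<subseteq> topspace (mtop A)" by (rule openin_subset)
qed

definition smooth_map ::
  "('a, 'e::real_normed_vector) atlas \<Rightarrow> ('b, 'f::real_normed_vector) atlas \<Rightarrow> ('a \<Rightarrow> 'b) \<Rightarrow> bool" where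
  "smooth_map M Y f \<longleftrightarrow> continuous_map (mtop M) (mtop Y) f \<and>
     (\<forall>(V, \<phi>)\<in>charts M. \<forall>(W, \<psi>)\<in>charts Y.
        smooth_on (\<phi> ` (V \<inter> f -` W)) (\<psi> \<circ> f \<circ> inv_into V \<phi>))"

definition open_atlas :: "'e set \<Rightarrow> ('e, 'e) atlas" where
  "open_atlas U = {(U, \<lambda>x. x)}"

definition prod_atlas :: "('a, 'e) atlas \<Rightarrow> ('b, 'f) atlas \<Rightarrow> ('a \<times> 'b, 'e \<times> 'f) atlas" where
  "prod_atlas A B = {(V \<times> W, map_prod \<phi> \<psi>) | V \<phi> W \<psi>. (V, \<phi>) \<in> A \<and> (W, \<psi>) \<in> B}"

section \<open>Tangent bundle\<close>

text \<open>
  A tangent vector at \<open>p\<close> is an assignment of a coordinate vector to every chart around \<open>p\<close>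
  that transforms by the derivatives of the chart changes; it is \<open>0\<close> (by convention) on everything
  that is not a chart around \<open>p\<close>. Points of \<open>TX\<close> are pairs of a base point and such a vector.
\<close>

type_synonym ('a, 'e) tvec = "('a, 'e) chart \<Rightarrow> 'e"
type_synonym ('a, 'e) field = "'a \<Rightarrow> 'a \<times> ('a, 'e) tvec"

definition charts_at :: "('a, 'e::real_normed_vector) atlas \<Rightarrow> 'a \<Rightarrow> ('a, 'e) atlas" where
  "charts_at X p = {(V, \<phi>) \<in> charts X. p \<in> V}"

definition tangent_space :: "('a, 'e::real_normed_vector) atlas \<Rightarrow> 'a \<Rightarrow> ('a, 'e) tvec set" where
  "tangent_space X p = {v.
     (\<forall>(V, \<phi>)\<in>charts_at X p. \<forall>(W, \<psi>)\<in>charts_at X p.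
        v (W, \<psi>) = frechet_derivative (\<psi> \<circ> inv_into V \<phi>) (at (\<phi> p)) (v (V, \<phi>))) \<and>
     (\<forall>c. c \<notin> charts_at X p \<longrightarrow> v c = 0)}"

definition tangent_over :: "('a, 'e::real_normed_vector) atlas \<Rightarrow> 'a set \<Rightarrow> ('a \<times> ('a, 'e) tvec) set" where
  "tangent_over X V = {(p, v). p \<in> V \<and> v \<in> tangent_space X p}"

definition tangent_chart :: "('a, 'e) chart \<Rightarrow> 'a \<times> ('a, 'e) tvec \<Rightarrow> 'e \<times> 'e" where
  "tangent_chart c = (\<lambda>(p, v). (snd c p, v c))"

definition tangent_atlas ::
  "('a, 'e::real_normed_vector) atlas \<Rightarrow> ('a \<times> ('a, 'e) tvec, 'e \<times> 'e) atlas" where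
  "tangent_atlas X = (\<lambda>c. (tangent_over X (fst c), tangent_chart c)) ` charts X"

text \<open>
  Vector bundle charts over \<open>W\<close>: fibrewise linear charts of the total space that cover a chart of \<open>X\<close>.
\<close>

definition vb_charts ::
  "('a, 'e::real_normed_vector) atlas \<Rightarrow> ('a set \<times> ('a \<times> ('a, 'e) tvec \<Rightarrow> 'e \<times> 'e)) set" where
  "vb_charts X = {(W, \<Theta>). \<exists>\<psi>. (W, \<psi>) \<in> charts X \<and>
     (tangent_over X W, \<Theta>) \<in> charts (tangent_atlas X) \<and>
     \<Theta> ` tangent_over X W = \<psi> ` W \<times> UNIV \<and>
     (\<forall>p\<in>W. \<forall>v\<in>tangent_space X p. fst (\<Theta> (p, v)) = \<psi> p) \<and>
     (\<forall>p\<in>W. \<forall>v\<in>tangent_space X p. \<forall>w\<in>tangent_space X p. \<forall>a b.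
        snd (\<Theta> (p, \<lambda>c. a *\<^sub>R v c + b *\<^sub>R w c)) = a *\<^sub>R snd (\<Theta> (p, v)) + b *\<^sub>R snd (\<Theta> (p, w)))}"

definition sections :: "('a, 'e::real_normed_vector) atlas \<Rightarrow> ('a, 'e) field set" where
  "sections X = {s. smooth_map X (tangent_atlas X) s \<and> (\<forall>p\<in>carrier X. fst (s p) = p)}"

definition velocity ::
  "('a, 'e::real_normed_vector) atlas \<Rightarrow> (real \<Rightarrow> 'a) \<Rightarrow> real \<Rightarrow> 'a \<times> ('a, 'e) tvec" where
  "velocity X \<gamma> t =
     (\<gamma> t, \<lambda>c. if c \<in> charts_at X (\<gamma> t) then vector_derivative (snd c \<circ> \<gamma>) (at t) else 0)"

section \<open>Riemannian metrics\<close>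

type_synonym ('a, 'e) metric = "'a \<Rightarrow> ('a, 'e) tvec \<Rightarrow> ('a, 'e) tvec \<Rightarrow> real"

definition riemannian_metric :: "('a, 'e::real_normed_vector) atlas \<Rightarrow> ('a, 'e) metric \<Rightarrow> bool" where
  "riemannian_metric X h \<longleftrightarrow>
     (\<forall>p\<in>carrier X. \<forall>u\<in>tangent_space X p. \<forall>v\<in>tangent_space X p.
        h p u v = h p v u \<and>
        (\<forall>w\<in>tangent_space X p. \<forall>a b.
           h p (\<lambda>c. a *\<^sub>R u c + b *\<^sub>R v c) w = a * h p u w + b * h p v w)) \<and>
     (\<forall>p\<in>carrier X. \<forall>v\<in>tangent_space X p. v \<noteq> (\<lambda>_. 0) \<longrightarrow> h p v v > 0) \<and>
     (\<forall>(V, \<phi>)\<in>charts X. smooth_on (\<phi> ` V \<times> UNIV \<times> UNIV)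
        (\<lambda>(x, a, b). h (inv_into V \<phi> x)
           (snd (inv_into (tangent_over X V) (tangent_chart (V, \<phi>)) (x, a)))
           (snd (inv_into (tangent_over X V) (tangent_chart (V, \<phi>)) (x, b)))))"

definition tnorm :: "('a, 'e) metric \<Rightarrow> 'a \<times> ('a, 'e) tvec \<Rightarrow> real" where
  "tnorm h z = sqrt (h (fst z) (snd z) (snd z))"

definition smooth_arc :: "('a, 'e::real_normed_vector) atlas \<Rightarrow> (real \<Rightarrow> 'a) \<Rightarrow> real \<Rightarrow> real \<Rightarrow> bool" where
  "smooth_arc X \<gamma> a b \<longleftrightarrow>
     (\<exists>U \<delta>. open U \<and> {a..b} \<subseteq> U \<and> smooth_map (open_atlas U) X \<delta> \<and> (\<forall>t\<in>{a..b}. \<gamma> t = \<delta> t))"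

definition piecewise_smooth :: "('a, 'e::real_normed_vector) atlas \<Rightarrow> (real \<Rightarrow> 'a) \<Rightarrow> bool" where
  "piecewise_smooth X \<gamma> \<longleftrightarrow>
     (\<exists>ts. ts \<noteq> [] \<and> sorted ts \<and> hd ts = 0 \<and> last ts = 1 \<and>
        (\<forall>i. Suc i < length ts \<longrightarrow> smooth_arc X \<gamma> (ts ! i) (ts ! Suc i)))"

definition curve_length ::
  "('a, 'e::real_normed_vector) atlas \<Rightarrow> ('a, 'e) metric \<Rightarrow> (real \<Rightarrow> 'a) \<Rightarrow> ennreal" where
  "curve_length X h \<gamma> = (\<integral>\<^sup>+t\<in>{0..1}. ennreal (tnorm h (velocity X \<gamma> t)) \<partial>lborel)"

text \<open>Extended-valued: points in different components have distance \<open>\<infinity>\<close>.\<close>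

definition riem_dist ::
  "('a, 'e::real_normed_vector) atlas \<Rightarrow> ('a, 'e) metric \<Rightarrow> 'a \<Rightarrow> 'a \<Rightarrow> ennreal" where
  "riem_dist X h p q = (INF \<gamma>\<in>{\<gamma>. piecewise_smooth X \<gamma> \<and> \<gamma> 0 = p \<and> \<gamma> 1 = q}. curve_length X h \<gamma>)"

definition complete_metric :: "('a, 'e::real_normed_vector) atlas \<Rightarrow> ('a, 'e) metric \<Rightarrow> bool" where
  "complete_metric X h \<longleftrightarrow>
     (\<forall>\<sigma>::nat \<Rightarrow> 'a. range \<sigma> \<subseteq> carrier X \<and>
        (\<forall>e>0. \<exists>N. \<forall>m\<ge>N. \<forall>n\<ge>N. riem_dist X h (\<sigma> m) (\<sigma> n) < e) \<longrightarrow>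
        (\<exists>p\<in>carrier X. (\<lambda>n. riem_dist X h (\<sigma> n) p) \<longlonglongrightarrow> 0))"

section \<open>Linear differential operators\<close>

definition field_rep ::
  "('a, 'e) chart \<Rightarrow> ('a, 'e) field \<Rightarrow> 'e \<Rightarrow> 'e" where
  "field_rep c s x = snd (s (inv_into (fst c) (snd c) x)) c"

text \<open>
  Operators of order at most \<open>k\<close>. In each chart, the operator is a finite sum of iterated
  derivatives in fixed directions \<open>vs i\<close>, of length at most \<open>k\<close>, followed by smooth
  endomorphism-valued coefficients \<open>a i\<close>; for directions taken from a basis these are the usual
  multi-index expressions.
\<close>

definition diff_op ::
  "('a, 'e::real_normed_vector) atlas \<Rightarrow> nat \<Rightarrow> (('a, 'e) field \<Rightarrow> ('a, 'e) field) \<Rightarrow> bool" where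
  "diff_op X k P \<longleftrightarrow> P ` sections X \<subseteq> sections X \<and>
     (\<forall>(V, \<phi>)\<in>charts X. \<exists>(n::nat) (a :: nat \<Rightarrow> 'e \<times> 'e \<Rightarrow> 'e) (vs :: nat \<Rightarrow> 'e list).
        (\<forall>i<n. length (vs i) \<le> k \<and> smooth_on (\<phi> ` V \<times> UNIV) (a i) \<and>
               (\<forall>x\<in>\<phi> ` V. linear (\<lambda>w. a i (x, w)))) \<and>
        (\<forall>s\<in>sections X. \<forall>p\<in>V.
           snd (P s p) (V, \<phi>) =
             (\<Sum>i<n. a i (\<phi> p, iter_deriv (vs i) (field_rep (V, \<phi>) s) (\<phi> p)))))"

section \<open>Asymptotics\<close>

text \<open>
  Nets are indexed by \<open>(0,1]\<close>; their values at other indices are irrelevant. The next definition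
  says that the supremum of \<open>f \<epsilon> p\<close> over \<open>p \<in> S \<epsilon>\<close> is \<open>O(\<epsilon>\<^sup>r)\<close>.

  Wherever a notion does not depend on the choice of a Riemannian metric or of a representative,
  it is required for some metric and some representative.
\<close>

definition unif_bigO :: "(real \<Rightarrow> 'p set) \<Rightarrow> (real \<Rightarrow> 'p \<Rightarrow> ennreal) \<Rightarrow> real \<Rightarrow> bool" where
  "unif_bigO S f r \<longleftrightarrow>
     (\<exists>C. \<forall>\<^sub>F \<epsilon> in at_right 0. \<forall>p\<in>S \<epsilon>. f \<epsilon> p \<le> ennreal (C * \<epsilon> powr r))"

section \<open>Generalized vector fields\<close>

definition mod_fields :: "('a, 'e::real_normed_vector) atlas \<Rightarrow> (real \<Rightarrow> ('a, 'e) field) set" where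
  "mod_fields X = {\<xi>. (\<forall>\<epsilon>\<in>{0<..1}. \<xi> \<epsilon> \<in> sections X) \<and>
     (\<exists>h. riemannian_metric X h \<and>
        (\<forall>k P K. diff_op X k P \<and> compactin (mtop X) K \<longrightarrow>
           (\<exists>N::nat. unif_bigO (\<lambda>_. K) (\<lambda>\<epsilon> p. ennreal (tnorm h (P (\<xi> \<epsilon>) p))) (- real N))))}"

definition negl_fields :: "('a, 'e::real_normed_vector) atlas \<Rightarrow> (real \<Rightarrow> ('a, 'e) field) set" where
  "negl_fields X = {\<xi> \<in> mod_fields X.
     \<exists>h. riemannian_metric X h \<and>
        (\<forall>K (m::nat). compactin (mtop X) K \<longrightarrow>
           unif_bigO (\<lambda>_. K) (\<lambda>\<epsilon> p. ennreal (tnorm h (\<xi> \<epsilon> p))) (real m))}"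

definition field_eqv ::
  "('a, 'e::real_normed_vector) atlas \<Rightarrow> ((real \<Rightarrow> ('a, 'e) field) \<times> (real \<Rightarrow> ('a, 'e) field)) set" where
  "field_eqv X = {(\<xi>, \<eta>). \<xi> \<in> mod_fields X \<and> \<eta> \<in> mod_fields X \<and>
     (\<lambda>\<epsilon> p. (p, \<lambda>c. snd (\<xi> \<epsilon> p) c - snd (\<eta> \<epsilon> p) c)) \<in> negl_fields X}"

definition gen_fields :: "('a, 'e::real_normed_vector) atlas \<Rightarrow> (real \<Rightarrow> ('a, 'e) field) set set" where
  "gen_fields X = mod_fields X // field_eqv X"

definition field_apply ::
  "('a, 'e::real_normed_vector) atlas \<Rightarrow> (('a, 'e) field \<Rightarrow> ('a, 'e) field) \<Rightarrow>
   (real \<Rightarrow> ('a, 'e) field) set \<Rightarrow> (real \<Rightarrow> ('a, 'e) field) set" where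
  "field_apply X P \<Xi> = (\<Union>\<xi>\<in>\<Xi>. field_eqv X `` {\<lambda>\<epsilon>. P (\<xi> \<epsilon>)})"

definition locally_bounded ::
  "('a, 'e::real_normed_vector) atlas \<Rightarrow> (real \<Rightarrow> ('a, 'e) field) set \<Rightarrow> bool" where
  "locally_bounded X \<Xi> \<longleftrightarrow> (\<exists>\<xi>\<in>\<Xi>. \<exists>h. riemannian_metric X h \<and>
     (\<forall>K. compactin (mtop X) K \<longrightarrow>
        (\<exists>C. \<forall>\<^sub>F \<epsilon> in at_right 0. \<forall>p\<in>K. tnorm h (\<xi> \<epsilon> p) \<le> C)))"

definition locally_Linf_log ::
  "('a, 'e::real_normed_vector) atlas \<Rightarrow> (real \<Rightarrow> ('a, 'e) field) set \<Rightarrow> bool" where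
  "locally_Linf_log X \<Xi> \<longleftrightarrow> (\<exists>\<xi>\<in>\<Xi>. \<exists>h. riemannian_metric X h \<and>
     (\<forall>K. compactin (mtop X) K \<longrightarrow>
        (\<exists>C. \<forall>\<^sub>F \<epsilon> in at_right 0. \<forall>p\<in>K. tnorm h (\<xi> \<epsilon> p) \<le> C * \<bar>ln \<epsilon>\<bar>)))"

definition globally_bounded ::
  "('a, 'e::real_normed_vector) atlas \<Rightarrow> ('a, 'e) metric \<Rightarrow> (real \<Rightarrow> ('a, 'e) field) set \<Rightarrow> bool" where
  "globally_bounded X h \<Xi> \<longleftrightarrow>
     (\<exists>\<xi>\<in>\<Xi>. \<exists>C>0. \<forall>\<^sub>F \<epsilon> in at_right 0. \<forall>p\<in>carrier X. tnorm h (\<xi> \<epsilon> p) \<le> C)"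

section \<open>Manifold-valued generalized functions\<close>

definition c_bounded ::
  "('a, 'e::real_normed_vector) atlas \<Rightarrow> ('b, 'f::real_normed_vector) atlas \<Rightarrow> (real \<Rightarrow> 'a \<Rightarrow> 'b) \<Rightarrow> bool" where
  "c_bounded M Y u \<longleftrightarrow> (\<forall>K. compactin (mtop M) K \<longrightarrow>
     (\<exists>K'. compactin (mtop Y) K' \<and> (\<forall>\<^sub>F \<epsilon> in at_right 0. u \<epsilon> ` K \<subseteq> K')))"

definition mod_maps ::
  "('a, 'e::real_normed_vector) atlas \<Rightarrow> ('b, 'f::real_normed_vector) atlas \<Rightarrow> (real \<Rightarrow> 'a \<Rightarrow> 'b) set" where
  "mod_maps M Y = {u. (\<forall>\<epsilon>\<in>{0<..1}. smooth_map M Y (u \<epsilon>)) \<and> c_bounded M Y u \<and>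
     (\<forall>k\<ge>1. \<forall>(V, \<phi>)\<in>charts M. \<forall>(W, \<psi>)\<in>charts Y. \<forall>L L'.
        compactin (mtop M) L \<and> L \<subseteq> V \<and> compactin (mtop Y) L' \<and> L' \<subseteq> W \<longrightarrow>
        (\<exists>N::nat. unif_bigO (\<lambda>\<epsilon>. L \<inter> u \<epsilon> -` L')
           (\<lambda>\<epsilon> p. deriv_norm k (\<psi> \<circ> u \<epsilon> \<circ> inv_into V \<phi>) (\<phi> p)) (- real N)))}"

definition unif_close ::
  "('a, 'e::real_normed_vector) atlas \<Rightarrow> ('b, 'f::real_normed_vector) atlas \<Rightarrow>
   (real \<Rightarrow> 'a \<Rightarrow> 'b) \<Rightarrow> (real \<Rightarrow> 'a \<Rightarrow> 'b) \<Rightarrow> bool" where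
  "unif_close M Y u v \<longleftrightarrow> (\<exists>h. riemannian_metric Y h \<and>
     (\<forall>K. compactin (mtop M) K \<longrightarrow>
        ((\<lambda>\<epsilon>. SUP p\<in>K. riem_dist Y h (u \<epsilon> p) (v \<epsilon> p)) \<longlongrightarrow> 0) (at_right 0)))"

definition map_eqv ::
  "('a, 'e::real_normed_vector) atlas \<Rightarrow> ('b, 'f::real_normed_vector) atlas \<Rightarrow>
   ((real \<Rightarrow> 'a \<Rightarrow> 'b) \<times> (real \<Rightarrow> 'a \<Rightarrow> 'b)) set" where
  "map_eqv M Y = {(u, v). u \<in> mod_maps M Y \<and> v \<in> mod_maps M Y \<and> unif_close M Y u v \<and>
     (\<forall>k m::nat. \<forall>(V, \<phi>)\<in>charts M. \<forall>(W, \<psi>)\<in>charts Y. \<forall>L L'.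
        compactin (mtop M) L \<and> L \<subseteq> V \<and> compactin (mtop Y) L' \<and> L' \<subseteq> W \<longrightarrow>
        unif_bigO (\<lambda>\<epsilon>. L \<inter> u \<epsilon> -` L' \<inter> v \<epsilon> -` L')
          (\<lambda>\<epsilon> p. deriv_norm k
             (\<lambda>x. (\<psi> \<circ> u \<epsilon> \<circ> inv_into V \<phi>) x - (\<psi> \<circ> v \<epsilon> \<circ> inv_into V \<phi>) x) (\<phi> p)) (real m))}"

definition gen_maps ::
  "('a, 'e::real_normed_vector) atlas \<Rightarrow> ('b, 'f::real_normed_vector) atlas \<Rightarrow>
   (real \<Rightarrow> 'a \<Rightarrow> 'b) set set" where
  "gen_maps M Y = mod_maps M Y // map_eqv M Y"

definition fast_assoc ::
  "('a, 'e::real_normed_vector) atlas \<Rightarrow> ('b, 'f::real_normed_vector) atlas \<Rightarrow>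
   (real \<Rightarrow> 'a \<Rightarrow> 'b) set \<Rightarrow> ('a \<Rightarrow> 'b) \<Rightarrow> bool" where
  "fast_assoc X Y U v \<longleftrightarrow> (\<exists>u\<in>U. \<exists>h. riemannian_metric Y h \<and>
     (\<forall>p\<in>carrier X. \<forall>m::nat.
        unif_bigO (\<lambda>_. {p}) (\<lambda>\<epsilon> q. riem_dist Y h (u \<epsilon> q) (v q)) (real m)))"

definition zero_assoc ::
  "('a, 'e::real_normed_vector) atlas \<Rightarrow> ('b, 'f::real_normed_vector) atlas \<Rightarrow>
   (real \<Rightarrow> 'a \<Rightarrow> 'b) set \<Rightarrow> ('a \<Rightarrow> 'b) \<Rightarrow> bool" where
  "zero_assoc X Y U v \<longleftrightarrow> (\<exists>u\<in>U. unif_close X Y u (\<lambda>_. v))"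

section \<open>Hybrid generalized functions\<close>

definition mod_hybrid ::
  "('b, 'f::real_normed_vector) atlas \<Rightarrow> ('a, 'e::real_normed_vector) atlas \<Rightarrow>
   (real \<Rightarrow> 'b \<Rightarrow> 'a \<times> ('a, 'e) tvec) set" where
  "mod_hybrid M X = {u. (\<forall>\<epsilon>\<in>{0<..1}. smooth_map M (tangent_atlas X) (u \<epsilon>)) \<and>
     c_bounded M X (\<lambda>\<epsilon>. fst \<circ> u \<epsilon>) \<and>
     (\<forall>k. \<forall>(V, \<phi>)\<in>charts M. \<forall>(W, \<Theta>)\<in>vb_charts X. \<forall>L L'.
        compactin (mtop M) L \<and> L \<subseteq> V \<and> compactin (mtop X) L' \<and> L' \<subseteq> W \<longrightarrow>
        (\<exists>N::nat. unif_bigO (\<lambda>\<epsilon>. L \<inter> (fst \<circ> u \<epsilon>) -` L')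
           (\<lambda>\<epsilon> p. deriv_norm k (\<Theta> \<circ> u \<epsilon> \<circ> inv_into V \<phi>) (\<phi> p)) (- real N)))}"

definition hybrid_eqv ::
  "('b, 'f::real_normed_vector) atlas \<Rightarrow> ('a, 'e::real_normed_vector) atlas \<Rightarrow>
   ((real \<Rightarrow> 'b \<Rightarrow> 'a \<times> ('a, 'e) tvec) \<times> (real \<Rightarrow> 'b \<Rightarrow> 'a \<times> ('a, 'e) tvec)) set" where
  "hybrid_eqv M X = {(u, v). u \<in> mod_hybrid M X \<and> v \<in> mod_hybrid M X \<and>
     unif_close M X (\<lambda>\<epsilon>. fst \<circ> u \<epsilon>) (\<lambda>\<epsilon>. fst \<circ> v \<epsilon>) \<and>
     (\<forall>k m::nat. \<forall>(V, \<phi>)\<in>charts M. \<forall>(W, \<Theta>)\<in>vb_charts X. \<forall>L L'.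
        compactin (mtop M) L \<and> L \<subseteq> V \<and> compactin (mtop X) L' \<and> L' \<subseteq> W \<longrightarrow>
        unif_bigO (\<lambda>\<epsilon>. L \<inter> (fst \<circ> u \<epsilon>) -` L' \<inter> (fst \<circ> v \<epsilon>) -` L')
          (\<lambda>\<epsilon> p. deriv_norm k
             (\<lambda>x. (\<Theta> \<circ> u \<epsilon> \<circ> inv_into V \<phi>) x - (\<Theta> \<circ> v \<epsilon> \<circ> inv_into V \<phi>) x) (\<phi> p)) (real m))}"

section \<open>Generalized flows\<close>

abbreviation R_times :: "('a, 'e) atlas \<Rightarrow> (real \<times> 'a, real \<times> 'e) atlas" where
  "R_times X \<equiv> prod_atlas (open_atlas UNIV) X"

abbreviation R2_times :: "('a, 'e) atlas \<Rightarrow> ((real \<times> real) \<times> 'a, (real \<times> real) \<times> 'e) atlas" where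
  "R2_times X \<equiv> prod_atlas (open_atlas UNIV) X"

text \<open>
  Equality of classes is expressed by equivalence of representatives; both sides are thereby also
  required to be moderate.
\<close>

definition generalized_flow ::
  "('a, 'e::real_normed_vector) atlas \<Rightarrow> (real \<Rightarrow> ('a, 'e) field) set \<Rightarrow>
   (real \<Rightarrow> real \<times> 'a \<Rightarrow> 'a) set \<Rightarrow> bool" where
  "generalized_flow X \<Xi> \<Phi> \<longleftrightarrow> \<Phi> \<in> gen_maps (R_times X) X \<and>
     (\<exists>u\<in>\<Phi>. \<exists>\<xi>\<in>\<Xi>.
        ((\<lambda>\<epsilon> (t, x). velocity X (\<lambda>\<tau>. u \<epsilon> (\<tau>, x)) t), (\<lambda>\<epsilon> (t, x). \<xi> \<epsilon> (u \<epsilon> (t, x))))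
          \<in> hybrid_eqv (R_times X) X \<and>
        ((\<lambda>\<epsilon> x. u \<epsilon> (0, x)), (\<lambda>\<epsilon> x. x)) \<in> map_eqv X X \<and>
        ((\<lambda>\<epsilon> ((t, s), x). u \<epsilon> (t + s, x)), (\<lambda>\<epsilon> ((t, s), x). u \<epsilon> (t, u \<epsilon> (s, x))))
          \<in> map_eqv (R2_times X) X)"

definition G_complete ::
  "('a, 'e::real_normed_vector) atlas \<Rightarrow> (real \<Rightarrow> ('a, 'e) field) set \<Rightarrow> bool" where
  "G_complete X \<Xi> \<longleftrightarrow> (\<exists>!\<Phi>. generalized_flow X \<Xi> \<Phi>)"

definition time_slice ::
  "('a, 'e::real_normed_vector) atlas \<Rightarrow> (real \<Rightarrow> real \<times> 'a \<Rightarrow> 'a) set \<Rightarrow> real \<Rightarrow>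
   (real \<Rightarrow> 'a \<Rightarrow> 'a) set" where
  "time_slice X \<Phi> t = (\<Union>u\<in>\<Phi>. map_eqv X X `` {\<lambda>\<epsilon> x. u \<epsilon> (t, x)})"

definition flow_property :: "('a, 'e) atlas \<Rightarrow> (real \<times> 'a \<Rightarrow> 'a) \<Rightarrow> bool" where
  "flow_property X \<Psi> \<longleftrightarrow> (\<forall>s t. \<forall>p\<in>carrier X. \<Psi> (s + t, p) = \<Psi> (s, \<Psi> (t, p)))"

end

theory Submission
  imports Defs
begin

text \<open>
  A curve that starts in a coordinate ball has Riemannian length at least a constant times the
  coordinate distance it covers before leaving the doubled ball. Hence smallness of the Riemannian
  distance controls coordinates, and limits along nets can be carried across equivalences of nets,
  for whichever metric witnesses the equivalence. By the group law, a representative \<open>w\<close> of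
  \<open>\<Phi>(s, \<cdot>)\<close> evaluated at the moving points \<open>u\<^sub>\<epsilon>(t, p)\<close> converges to \<open>\<Psi>(s + t, p)\<close>, so everything
  reduces to showing that it also converges to \<open>\<Psi>(s, \<Psi>(t, p))\<close>. For zero-association, \<open>\<Psi>(s, \<cdot>)\<close> is a
  locally uniform limit of continuous maps, hence continuous. For fast association,
  \<open>u\<^sub>\<epsilon>(t, p) \<longlonglongrightarrow> \<Psi>(t, p)\<close> faster than any power of \<open>\<epsilon>\<close>, which beats the moderate growth of the
  derivatives of \<open>w\<close>.
\<close>

section \<open>Iterated derivatives\<close>

text \<open>Fast association is a statement about fixed points and does not by itself make
  \<open>\<Psi>\<close> continuous, while the group law evaluates the outer factor at points that
  move with \<epsilon>. The moving argument therefore has to be handled inside the smooth net. The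
  obstacle there is a circularity: moderateness bounds derivatives only where the values already lie
  in a compact part of one chart, yet this bound is what is to keep them there. Comparing Riemannian
  length with coordinates has the same defect, since length controls coordinate displacement only
  while the curve stays in the chart. Both are resolved by one first-exit argument,
  \<open>exit_coordinate_ball\<close>; the pair of radii r and 2 r comes from it, the spare r being
  the room for the estimate. Each equivalence and each association supplies its own metric and its
  own representative. Therefore only metric-free consequences are passed on: \<open>limitin\<close>
  in the manifold topology and, for rates, \<open>rapidly_near\<close> in one fixed chart.\<close>

lemma smooth_on_differentiable:
  "smooth_on S f \<Longrightarrow> x \<in> S \<Longrightarrow> f differentiable (at x)"
  unfolding smooth_on_def by (drule spec[of _ "[]"]) simp

lemma smooth_on_continuous_on: "smooth_on S f \<Longrightarrow> continuous_on S f"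
  by (meson continuous_at_imp_continuous_on differentiable_imp_continuous_within
      smooth_on_differentiable)

text \<open>\<open>frechet_derivative\<close> at a point depends only on the germ there, and
  openness keeps the agreement valid at nearby points, which the next derivative sees. Coordinate
  expressions built with \<open>inv_into\<close> have their simple form only on such a set.\<close>

lemma iter_deriv_cong_open:
  assumes "open S" "\<And>x. x \<in> S \<Longrightarrow> f x = g x" "x \<in> S"
  shows "iter_deriv vs f x = iter_deriv vs g x"
  using assms(3)
proof (induction vs arbitrary: x)
  case (Cons v vs)
  have "(iter_deriv vs f has_derivative D) (at x) \<longleftrightarrow> (iter_deriv vs g has_derivative D) (at x)" for D
    using has_derivative_transform_within_open[OF _ assms(1) Cons.prems] Cons.IH by metis
  then show ?case by (simp add: frechet_derivative_def)
qed (use assms in simp)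

lemma smooth_on_cong_open:
  assumes "open S" "\<And>x. x \<in> S \<Longrightarrow> f x = g x" "smooth_on S f"
  shows "smooth_on S g"
  unfolding smooth_on_def
proof (intro allI ballI)
  fix vs x assume x: "x \<in> S"
  from assms(3) x obtain D where "(iter_deriv vs f has_derivative D) (at x)"
    unfolding smooth_on_def differentiable_def by blast
  then have "(iter_deriv vs g has_derivative D) (at x)"
    by (rule has_derivative_transform_within_open[OF _ assms(1) x])
      (rule iter_deriv_cong_open[OF assms(1,2)])
  then show "iter_deriv vs g differentiable (at x)" unfolding differentiable_def by blast
qed

lemma deriv_norm_0: "deriv_norm 0 f x = ennreal (norm (f x))"
proof -
  have "{vs :: 'a list. length vs = 0 \<and> (\<forall>v\<in>set vs. norm v \<le> 1)} = {[]}" by auto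
  then show ?thesis by (simp add: deriv_norm_def)
qed

text \<open>At order one the supremum in \<open>deriv_norm\<close> runs over single vectors of norm
  at most one, so normalising the direction and using linearity yields an operator norm
  bound.\<close>

lemma deriv_norm_1_bound:
  assumes "deriv_norm 1 f x \<le> ennreal B" "B \<ge> 0" "f differentiable (at x)"
  shows "norm (frechet_derivative f (at x) d) \<le> B * norm d"
proof (cases "d = 0")
  case True
  then show ?thesis
    using linear_0[OF linear_frechet_derivative[OF assms(3)]] by simp
next
  case False
  let ?v = "(1 / norm d) *\<^sub>R d"
  have "ennreal (norm (iter_deriv [?v] f x)) \<le> deriv_norm 1 f x"
    unfolding deriv_norm_def by (rule SUP_upper) (use False in auto)
  then have "norm (frechet_derivative f (at x) ?v) \<le> B"
    using assms by (simp, metis ennreal_le_iff order_trans)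
  then show ?thesis
    using False by (simp add: linear_cmul[OF linear_frechet_derivative[OF assms(3)]] divide_simps)
qed

text \<open>The first derivative of the identity is already a constant function, and constants
  differentiate to constants, so the disjunction is stable under induction.\<close>

lemma iter_deriv_id: "iter_deriv vs (\<lambda>x. x) = (\<lambda>x. x) \<or> (\<exists>c. iter_deriv vs (\<lambda>x. x) = (\<lambda>_. c))"
  by (induction vs) (auto simp: frechet_derivative_ident)

lemma smooth_on_id: "smooth_on S (\<lambda>x. x)"
  unfolding smooth_on_def
proof (intro allI ballI)
  fix vs :: "'a list" and x
  show "iter_deriv vs (\<lambda>x. x) differentiable (at x)"
    using iter_deriv_id[of vs] by auto
qed

section \<open>Smoothness of product maps\<close>

lemma has_derivative_map_prod:
  assumes "(f has_derivative f') (at x)" "(g has_derivative g') (at y)"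
  shows "(map_prod f g has_derivative map_prod f' g') (at (x, y))"
proof -
  have "((\<lambda>z. f (fst z)) has_derivative (\<lambda>z. f' (fst z))) (at (x, y))"
    by (rule has_derivative_compose[of fst fst]) (use assms in \<open>auto intro!: derivative_eq_intros\<close>)
  moreover have "((\<lambda>z. g (snd z)) has_derivative (\<lambda>z. g' (snd z))) (at (x, y))"
    by (rule has_derivative_compose[of snd snd]) (use assms in \<open>auto intro!: derivative_eq_intros\<close>)
  ultimately have "((\<lambda>z. (f (fst z), g (snd z))) has_derivative (\<lambda>z. (f' (fst z), g' (snd z)))) (at (x, y))"
    by (rule has_derivative_Pair)
  then show ?thesis by (simp add: map_prod_def case_prod_unfold)
qed

text \<open>The derivative of a product map acts separately on the two components of a direction, so
  a list of directions splits into two lists of the same length.\<close>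

lemma iter_deriv_map_prod:
  assumes "open S" "open T" "smooth_on S f" "smooth_on T g" "x \<in> S" "y \<in> T"
  shows "iter_deriv vs (map_prod f g) (x, y) =
           (iter_deriv (map fst vs) f x, iter_deriv (map snd vs) g y)"
  using assms(5,6)
proof (induction vs arbitrary: x y)
  case (Cons v vs)
  let ?F = "iter_deriv (map fst vs) f" and ?G = "iter_deriv (map snd vs) g"
  have "(?F has_derivative frechet_derivative ?F (at x)) (at x)"
    and "(?G has_derivative frechet_derivative ?G (at y)) (at y)"
    using assms Cons.prems by (auto simp: smooth_on_def frechet_derivative_works[symmetric])
  then have D: "(map_prod ?F ?G has_derivative
      map_prod (frechet_derivative ?F (at x)) (frechet_derivative ?G (at y))) (at (x, y))"
    by (rule has_derivative_map_prod)
  have "(iter_deriv vs (map_prod f g) has_derivative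
      map_prod (frechet_derivative ?F (at x)) (frechet_derivative ?G (at y))) (at (x, y))"
  proof (rule has_derivative_transform_within_open[OF D])
    show "open (S \<times> T)" using assms by (simp add: open_Times)
    show "(x, y) \<in> S \<times> T" using Cons.prems by simp
    show "map_prod ?F ?G z = iter_deriv vs (map_prod f g) z" if "z \<in> S \<times> T" for z
      using Cons.IH that by auto
  qed
  then have "frechet_derivative (iter_deriv vs (map_prod f g)) (at (x, y)) =
      map_prod (frechet_derivative ?F (at x)) (frechet_derivative ?G (at y))"
    using frechet_derivative_at by metis
  then show ?case by (cases v) simp
qed simp

lemma smooth_on_map_prod:
  assumes "open S" "open T" "smooth_on S f" "smooth_on T g"
  shows "smooth_on (S \<times> T) (map_prod f g)"
  unfolding smooth_on_def
proof (intro allI ballI)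
  fix vs z assume z: "z \<in> S \<times> T"
  let ?F = "iter_deriv (map fst vs) f" and ?G = "iter_deriv (map snd vs) g"
  have "(?F has_derivative frechet_derivative ?F (at (fst z))) (at (fst z))"
    and "(?G has_derivative frechet_derivative ?G (at (snd z))) (at (snd z))"
    using assms z by (auto simp: smooth_on_def frechet_derivative_works[symmetric])
  then have D: "(map_prod ?F ?G has_derivative
      map_prod (frechet_derivative ?F (at (fst z))) (frechet_derivative ?G (at (snd z)))) (at z)"
    using has_derivative_map_prod by (metis prod.collapse)
  have "(iter_deriv vs (map_prod f g) has_derivative
      map_prod (frechet_derivative ?F (at (fst z))) (frechet_derivative ?G (at (snd z)))) (at z)"
  proof (rule has_derivative_transform_within_open[OF D])
    show "open (S \<times> T)" using assms by (simp add: open_Times)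
    show "map_prod ?F ?G z = iter_deriv vs (map_prod f g) z" if "z \<in> S \<times> T" for z
      using iter_deriv_map_prod[OF assms] that by auto
  qed (fact z)
  then show "iter_deriv vs (map_prod f g) differentiable (at z)"
    unfolding differentiable_def by blast
qed

section \<open>Topology of a manifold in coordinates\<close>

text \<open>Injectivity makes images commute with intersections, which is what the topology axioms
  require. The weaker assumption covers \<open>open_atlas\<close> and product atlases, whose charts
  are not yet known to be compatible.\<close>

lemma openin_mtop_inj:
  assumes inj: "\<And>V \<phi>. (V, \<phi>) \<in> A \<Longrightarrow> inj_on \<phi> V"
  shows "openin (mtop A) U \<longleftrightarrow> U \<subseteq> carrier A \<and> (\<forall>(V, \<phi>)\<in>A. open (\<phi> ` (U \<inter> V)))"
proof -
  have "istopology (\<lambda>U. U \<subseteq> carrier A \<and> (\<forall>(V, \<phi>)\<in>A. open (\<phi> ` (U \<inter> V))))"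
    unfolding istopology_def
  proof (intro conjI allI impI; clarify?)
    fix S T V \<phi>
    assume S: "\<forall>(V, \<phi>)\<in>A. open (\<phi> ` (S \<inter> V))" and T: "\<forall>(V, \<phi>)\<in>A. open (\<phi> ` (T \<inter> V))"
      and c: "(V, \<phi>) \<in> A"
    have "\<phi> ` (S \<inter> T \<inter> V) = \<phi> ` (S \<inter> V) \<inter> \<phi> ` (T \<inter> V)"
      using inj[OF c] by (auto simp: inj_on_def)
    then show "open (\<phi> ` (S \<inter> T \<inter> V))" using S T c by auto
  next
    fix \<K> V \<phi>
    assume K: "\<forall>K\<in>\<K>. K \<subseteq> carrier A \<and> (\<forall>(V, \<phi>)\<in>A. open (\<phi> ` (K \<inter> V)))" and c: "(V, \<phi>) \<in> A"
    have "\<phi> ` (\<Union>\<K> \<inter> V) = (\<Union>K\<in>\<K>. \<phi> ` (K \<inter> V))" by auto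
    moreover have "open (\<Union>K\<in>\<K>. \<phi> ` (K \<inter> V))" using K c by (intro open_UN) auto
    ultimately show "open (\<phi> ` (\<Union>\<K> \<inter> V))" by simp
  qed auto
  then show ?thesis by (simp add: mtop_def)
qed

lemma smooth_manifold_charts: "smooth_manifold X \<Longrightarrow> X \<subseteq> charts X"
  by (simp add: smooth_manifold_def)

lemma charts_inj_on: "(V, \<phi>) \<in> charts X \<Longrightarrow> inj_on \<phi> V"
  by (simp add: charts_def)

lemma charts_open_image: "(V, \<phi>) \<in> charts X \<Longrightarrow> open (\<phi> ` V)"
  by (simp add: charts_def)

lemma carrier_in_atlas:
  assumes "p \<in> carrier X" obtains V \<phi> where "(V, \<phi>) \<in> X" "p \<in> V"
  using assms by (auto simp: carrier_def)

text \<open>The topology is tested by charts of \<open>X\<close> alone, whereas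
  \<open>(V, \<phi>)\<close> is any chart of the maximal atlas; compatibility supplies the
  continuous transition map through which \<open>G\<close> is pulled back.\<close>

lemma openin_chart_vimage:
  assumes X: "X \<subseteq> charts X" and c: "(V, \<phi>) \<in> charts X" and G: "open G"
  shows "openin (mtop X) (V \<inter> \<phi> -` G)"
  unfolding openin_mtop[OF X]
proof (intro conjI ballI; clarify?)
  fix x assume "x \<in> V" then show "x \<in> carrier X" using c by (auto simp: charts_def)
next
  fix Z \<zeta> assume Z: "(Z, \<zeta>) \<in> X"
  then have comp: "compatible (V, \<phi>) (Z, \<zeta>)" using c by (auto simp: charts_def)
  have inj: "inj_on \<zeta> Z" using Z X charts_inj_on by blast
  have op: "open (\<zeta> ` (V \<inter> Z))" and co: "continuous_on (\<zeta> ` (V \<inter> Z)) (\<phi> \<circ> inv_into Z \<zeta>)"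
    using comp by (auto simp only: compatible_def prod.case intro!: smooth_on_continuous_on)
  have "\<zeta> ` (V \<inter> \<phi> -` G \<inter> Z) = (\<phi> \<circ> inv_into Z \<zeta>) -` G \<inter> \<zeta> ` (V \<inter> Z)"
    using inj by auto
  then show "open (\<zeta> ` (V \<inter> \<phi> -` G \<inter> Z))"
    using co op G by (metis continuous_on_open_vimage)
qed

lemma openin_chart:
  assumes "X \<subseteq> charts X" "(V, \<phi>) \<in> charts X"
  shows "openin (mtop X) V"
  using openin_chart_vimage[OF assms, of UNIV] by simp

lemma continuous_map_chart:
  assumes "X \<subseteq> charts X" "(V, \<phi>) \<in> charts X"
  shows "continuous_map (subtopology (mtop X) V) euclidean \<phi>"
proof -
  have "V \<subseteq> topspace (mtop X)" using openin_chart[OF assms] by (rule openin_subset)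
  then have "{x \<in> topspace (subtopology (mtop X) V). \<phi> x \<in> U} = V \<inter> \<phi> -` U" for U by auto
  moreover have "openin (subtopology (mtop X) V) (V \<inter> \<phi> -` U)" if "open U" for U
    using openin_chart_vimage[OF assms that] by (auto simp: openin_subtopology)
  ultimately show ?thesis by (auto simp: continuous_map_def)
qed

lemma continuous_map_chart_inv:
  assumes X: "X \<subseteq> charts X" and c: "(V, \<phi>) \<in> X"
  shows "continuous_map (top_of_set (\<phi> ` V)) (mtop X) (inv_into V \<phi>)"
proof -
  have inj: "inj_on \<phi> V" and op: "open (\<phi> ` V)"
    using assms charts_inj_on charts_open_image by blast+
  have "V \<subseteq> topspace (mtop X)"
    using openin_chart[OF X] c X by (meson openin_subset subsetD)
  moreover have "openin (top_of_set (\<phi> ` V)) {x \<in> \<phi> ` V. inv_into V \<phi> x \<in> U}"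
    if "openin (mtop X) U" for U
  proof -
    have "{x \<in> \<phi> ` V. inv_into V \<phi> x \<in> U} = \<phi> ` (U \<inter> V)" using inj by auto
    moreover have "open (\<phi> ` (U \<inter> V))" using that c unfolding openin_mtop[OF X] by auto
    ultimately show ?thesis using op by (auto simp: openin_open_eq)
  qed
  ultimately show ?thesis by (auto simp: continuous_map_def inv_into_into)
qed

text \<open>Closed balls of the model space are compact by \<open>heine_borel\<close>, and the
  inverse chart carries them over. They serve as \<open>L\<close>, \<open>L'\<close> and
  \<open>K\<close> in the later appeals to uniform estimates.\<close>

lemma compactin_coordinate_ball:
  fixes X :: "('a, 'e::{real_inner,heine_borel}) atlas"
  assumes X: "X \<subseteq> charts X" and c: "(V, \<phi>) \<in> X" and b: "cball z r \<subseteq> \<phi> ` V"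
  shows "compactin (mtop X) (V \<inter> \<phi> -` cball z r)"
proof -
  have inj: "inj_on \<phi> V" using X c charts_inj_on by blast
  have "V \<inter> \<phi> -` cball z r = inv_into V \<phi> ` cball z r"
  proof (intro equalityI subsetI)
    fix x assume "x \<in> V \<inter> \<phi> -` cball z r"
    then show "x \<in> inv_into V \<phi> ` cball z r"
      using inv_into_f_f[OF inj] by (metis IntE image_eqI vimageE)
  next
    fix x assume "x \<in> inv_into V \<phi> ` cball z r"
    then show "x \<in> V \<inter> \<phi> -` cball z r"
      using b by (auto simp: inv_into_into f_inv_into_f subset_iff)
  qed
  moreover have "compactin (top_of_set (\<phi> ` V)) (cball z r)"
    using b by (simp add: compactin_subtopology)
  ultimately show ?thesis
    using image_compactin continuous_map_chart_inv[OF X c] by metis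
qed

lemma coordinate_ball_in_open:
  assumes X: "X \<subseteq> charts X" and c: "(V, \<phi>) \<in> X" and U: "openin (mtop X) U" "q \<in> U" "q \<in> V"
  obtains r where "r > 0" "cball (\<phi> q) r \<subseteq> \<phi> ` V" "V \<inter> \<phi> -` cball (\<phi> q) r \<subseteq> U"
proof -
  have inj: "inj_on \<phi> V" using X c charts_inj_on by blast
  have "open (\<phi> ` (U \<inter> V))" using U c unfolding openin_mtop[OF X] by auto
  then obtain r where r: "r > 0" "cball (\<phi> q) r \<subseteq> \<phi> ` (U \<inter> V)"
    using U open_contains_cball by (metis IntI imageI)
  show ?thesis
  proof
    show "V \<inter> \<phi> -` cball (\<phi> q) r \<subseteq> U"
    proof
      fix x assume x: "x \<in> V \<inter> \<phi> -` cball (\<phi> q) r"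
      then obtain y where "y \<in> U \<inter> V" "\<phi> x = \<phi> y" using r(2) by blast
      then show "x \<in> U" using inj x by (auto simp: inj_on_def)
    qed
  qed (use r in auto)
qed

lemma coordinate_ball:
  assumes X: "X \<subseteq> charts X" and c: "(V, \<phi>) \<in> X" and q: "q \<in> V"
  obtains r where "r > 0" "cball (\<phi> q) r \<subseteq> \<phi> ` V"
  using coordinate_ball_in_open[OF X c openin_chart[OF X subsetD[OF X c]] q q] that by metis

text \<open>Coordinate balls form a neighbourhood base at \<open>q\<close>. Membership in
  \<open>V\<close> is stated separately because the values of \<open>\<phi>\<close> outside
  \<open>V\<close> are arbitrary and could be close to \<open>\<phi> q\<close> by accident.\<close>

lemma limitin_coordinates:
  assumes X: "X \<subseteq> charts X" and c: "(V, \<phi>) \<in> X" and q: "q \<in> V"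
  shows "limitin (mtop X) f q F \<longleftrightarrow> (\<forall>r>0. \<forall>\<^sub>F \<epsilon> in F. f \<epsilon> \<in> V \<and> dist (\<phi> (f \<epsilon>)) (\<phi> q) < r)"
    (is "?l \<longleftrightarrow> ?r")
proof
  assume l: ?l
  show ?r
  proof (intro allI impI)
    fix r :: real assume "r > 0"
    then have "\<forall>\<^sub>F \<epsilon> in F. f \<epsilon> \<in> V \<inter> \<phi> -` ball (\<phi> q) r"
      using l openin_chart_vimage[OF X subsetD[OF X c] open_ball, of "\<phi> q" r] q \<open>r > 0\<close>
      unfolding limitin_def by (metis IntI centre_in_ball vimageI)
    then show "\<forall>\<^sub>F \<epsilon> in F. f \<epsilon> \<in> V \<and> dist (\<phi> (f \<epsilon>)) (\<phi> q) < r"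
      by eventually_elim (auto simp: dist_commute)
  qed
next
  assume r: ?r
  show ?l
    unfolding limitin_def
  proof (intro conjI allI impI)
    show "q \<in> topspace (mtop X)" using c q by (auto simp: topspace_mtop[OF X] carrier_def)
    fix U assume U: "openin (mtop X) U \<and> q \<in> U"
    obtain s where s: "s > 0" "V \<inter> \<phi> -` cball (\<phi> q) s \<subseteq> U"
      using coordinate_ball_in_open[OF X c conjunct1[OF U] conjunct2[OF U] q] by metis
    have "\<forall>\<^sub>F \<epsilon> in F. f \<epsilon> \<in> V \<and> dist (\<phi> (f \<epsilon>)) (\<phi> q) < s" using r s(1) by blast
    then show "\<forall>\<^sub>F \<epsilon> in F. f \<epsilon> \<in> U"
    proof eventually_elim
      case (elim \<epsilon>)
      then have "f \<epsilon> \<in> V \<inter> \<phi> -` cball (\<phi> q) s" by (simp add: dist_commute)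
      then show ?case using s(2) by blast
    qed
  qed
qed

text \<open>A first-exit argument: \<open>step\<close> is an estimate available only while the curve
  stays in the closed ball of radius 2 r, and it limits the displacement to less than r. Having
  started within r of the centre, the curve cannot reach the boundary, so the provisional assumption
  of \<open>step\<close> holds on the whole interval.\<close>

lemma exit_coordinate_ball:
  fixes X :: "('a, 'e::{real_inner,heine_borel}) atlas"
  assumes man: "smooth_manifold X" and c: "(V, \<phi>) \<in> X" and b: "cball z (2 * r) \<subseteq> \<phi> ` V"
    and cont: "continuous_map (top_of_set {0..1}) (mtop X) \<gamma>"
    and start: "\<gamma> (0::real) \<in> V" "dist (\<phi> (\<gamma> 0)) z < r"
    and step: "\<And>T. 0 \<le> T \<Longrightarrow> T \<le> 1 \<Longrightarrow> \<gamma> ` {0..T} \<subseteq> V \<inter> \<phi> -` cball z (2 * r) \<Longrightarrow>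
                  dist (\<phi> (\<gamma> T)) (\<phi> (\<gamma> 0)) < r"
  shows "\<gamma> ` {0..1} \<subseteq> V \<inter> \<phi> -` ball z (2 * r)"
proof (rule ccontr)
  have X: "X \<subseteq> charts X" and H: "Hausdorff_space (mtop X)"
    using man by (auto simp: smooth_manifold_def)
  let ?O = "V \<inter> \<phi> -` ball z (2 * r)" and ?C = "V \<inter> \<phi> -` cball z (2 * r)"
  assume ne: "\<not> \<gamma> ` {0..1} \<subseteq> ?O"
  have opO: "openin (mtop X) ?O" using openin_chart_vimage[OF X subsetD[OF X c] open_ball] .
  \<comment> \<open>The ball is compact in a Hausdorff space, hence closed in the whole manifold. So
    the curve cannot leave \<open>V\<close> without first passing through the boundary of the
    ball.\<close>
  have clC: "closedin (mtop X) ?C"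
    using compactin_imp_closedin[OF H compactin_coordinate_ball[OF X c b]] .
  have range: "\<gamma> t \<in> topspace (mtop X)" if "t \<in> {0..1}" for t
    using continuous_map_image_subset_topspace[OF cont] that by auto
  define S where "S = {t \<in> {0..1}. \<gamma> t \<notin> ?O}"
  have "closedin (top_of_set {0..1}) S"
  proof -
    have "closedin (top_of_set {0..1}) {t \<in> topspace (top_of_set {0..1}). \<gamma> t \<in> topspace (mtop X) - ?O}"
      using cont opO closedin_continuous_map_preimage by blast
    moreover have "{t \<in> topspace (top_of_set {0..1}). \<gamma> t \<in> topspace (mtop X) - ?O} = S"
      using range by (auto simp: S_def)
    ultimately show ?thesis by simp
  qed
  then have clS: "closed S" using closedin_closed_trans closed_atLeastAtMost by blast
  have "S \<noteq> {}" using ne by (auto simp: S_def)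
  moreover have bdd: "bdd_below S" by (auto simp: S_def intro!: bdd_belowI[of _ 0])
  ultimately have T: "Inf S \<in> S" using clS closed_contains_Inf by blast
  \<comment> \<open>The first time outside the open ball, attained because \<open>S\<close> is
    closed.\<close>
  define T where "T = Inf S"
  have T01: "0 \<le> T" "T \<le> 1" "\<gamma> T \<notin> ?O" using T by (auto simp: S_def T_def)
  have before: "\<gamma> t \<in> ?O" if "0 \<le> t" "t < T" for t
  proof (rule ccontr)
    assume "\<gamma> t \<notin> ?O"
    then have "t \<in> S" using that T01 by (auto simp: S_def)
    then show False using cInf_lower[OF _ bdd] that by (force simp: T_def)
  qed
  have "\<gamma> 0 \<in> ?O" using start zero_le_dist[of "\<phi> (\<gamma> 0)" z]
    by (auto simp: dist_commute simp del: zero_le_dist)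
  then have "T > 0" using T01 by (metis order_le_less)
  \<comment> \<open>At the exit time the curve is a limit of points of the open ball, hence still in
    the closed one, and \<open>step\<close> applies up to and including \<open>T\<close>.\<close>
  have TC: "\<gamma> T \<in> ?C"
  proof -
    have "closedin (top_of_set {0..1}) {t \<in> topspace (top_of_set {0..1}). \<gamma> t \<in> ?C}"
      using cont clC closedin_continuous_map_preimage by blast
    then have "closed {t \<in> {0..1}. \<gamma> t \<in> ?C}"
      using closedin_closed_trans closed_atLeastAtMost by fastforce
    moreover have "{0..<T} \<subseteq> {t \<in> {0..1}. \<gamma> t \<in> ?C}"
      using before T01 by force
    ultimately have "closure {0..<T} \<subseteq> {t \<in> {0..1}. \<gamma> t \<in> ?C}"
      by (intro closure_minimal)
    moreover have "T \<in> closure {0..<T}" using closure_atLeastLessThan[OF \<open>T > 0\<close>] \<open>T > 0\<close> by simp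
    ultimately have "T \<in> {t \<in> {0..1}. \<gamma> t \<in> ?C}" by (rule subsetD)
    then show ?thesis by simp
  qed
  have "\<gamma> ` {0..T} \<subseteq> ?C"
  proof
    fix x assume "x \<in> \<gamma> ` {0..T}"
    then obtain t where "x = \<gamma> t" "0 \<le> t" "t \<le> T" by auto
    then show "x \<in> ?C" using before[of t] TC by (cases "t = T") auto
  qed
  then have "dist (\<phi> (\<gamma> T)) (\<phi> (\<gamma> 0)) < r" using step T01 by blast
  then have "dist z (\<phi> (\<gamma> T)) < 2 * r"
    using start dist_triangle[of z "\<phi> (\<gamma> T)" "\<phi> (\<gamma> 0)"] by (simp add: dist_commute)
  then show False using T01 TC by auto
qed

section \<open>Tangent vectors\<close>

text \<open>Membership in \<open>charts X\<close> gives compatibility with the charts of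
  \<open>X\<close> only, so the transition between two arbitrary charts is factored near
  \<open>p\<close> through a chart of \<open>X\<close>.\<close>

lemma transition_differentiable:
  assumes X: "X \<subseteq> charts X" and c: "(V, \<phi>) \<in> charts X" "(W, \<psi>) \<in> charts X"
    and p: "p \<in> V" "p \<in> W"
  shows "(\<psi> \<circ> inv_into V \<phi>) differentiable (at (\<phi> p))"
proof -
  have "p \<in> carrier X" using c p by (auto simp: charts_def)
  then obtain Z \<zeta> where Z: "(Z, \<zeta>) \<in> X" "p \<in> Z" by (rule carrier_in_atlas)
  have inj: "inj_on \<phi> V" "inj_on \<zeta> Z" using c Z X charts_inj_on by blast+
  have comp: "compatible (V, \<phi>) (Z, \<zeta>)" "compatible (W, \<psi>) (Z, \<zeta>)"
    using c Z by (auto simp: charts_def)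
  have op: "open (\<phi> ` (V \<inter> Z))" using comp by (simp add: compatible_def)
  have "smooth_on (\<phi> ` (V \<inter> Z)) (\<zeta> \<circ> inv_into V \<phi>)" "smooth_on (\<zeta> ` (W \<inter> Z)) (\<psi> \<circ> inv_into Z \<zeta>)"
    using comp unfolding compatible_def by simp_all
  then have "(\<zeta> \<circ> inv_into V \<phi>) differentiable (at (\<phi> p))"
    "(\<psi> \<circ> inv_into Z \<zeta>) differentiable (at ((\<zeta> \<circ> inv_into V \<phi>) (\<phi> p)))"
    using p Z inj by (auto intro!: smooth_on_differentiable)
  then have "((\<psi> \<circ> inv_into Z \<zeta>) \<circ> (\<zeta> \<circ> inv_into V \<phi>)) differentiable (at (\<phi> p))"
    by (rule differentiable_chain_at)
  then obtain D where D: "((\<psi> \<circ> inv_into Z \<zeta>) \<circ> (\<zeta> \<circ> inv_into V \<phi>) has_derivative D) (at (\<phi> p))"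
    unfolding differentiable_def by blast
  have "(\<psi> \<circ> inv_into V \<phi> has_derivative D) (at (\<phi> p))"
    by (rule has_derivative_transform_within_open[OF D op]) (use p Z inj in auto)
  then show ?thesis unfolding differentiable_def by blast
qed

text \<open>The transformation law of tangent vectors is the chain rule for
  \<open>\<psi> \<circ> \<gamma>\<close> written through \<open>\<phi>\<close>. That factorisation
  holds only where the curve lies in \<open>V\<close>, whence the assumption
  \<open>ev\<close>.\<close>

lemma velocity_in_tangent_space:
  assumes X: "X \<subseteq> charts X"
    and diff: "\<And>V \<phi>. (V, \<phi>) \<in> charts_at X (\<gamma> t) \<Longrightarrow> (\<phi> \<circ> \<gamma>) differentiable (at t)"
    and ev: "\<And>V \<phi>. (V, \<phi>) \<in> charts_at X (\<gamma> t) \<Longrightarrow> \<forall>\<^sub>F s in at t. \<gamma> s \<in> V"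
  shows "snd (velocity X \<gamma> t) \<in> tangent_space X (\<gamma> t)"
proof -
  have "vector_derivative (\<psi> \<circ> \<gamma>) (at t) =
      frechet_derivative (\<psi> \<circ> inv_into V \<phi>) (at (\<phi> (\<gamma> t))) (vector_derivative (\<phi> \<circ> \<gamma>) (at t))"
    if V: "(V, \<phi>) \<in> charts_at X (\<gamma> t)" and W: "(W, \<psi>) \<in> charts_at X (\<gamma> t)" for V \<phi> W \<psi>
  proof -
    have inj: "inj_on \<phi> V" using V charts_inj_on by (auto simp: charts_at_def)
    have "(\<phi> \<circ> \<gamma> has_vector_derivative vector_derivative (\<phi> \<circ> \<gamma>) (at t)) (at t)"
      using diff[OF V] vector_derivative_works by blast
    moreover have "(\<psi> \<circ> inv_into V \<phi> has_derivative
        frechet_derivative (\<psi> \<circ> inv_into V \<phi>) (at (\<phi> (\<gamma> t)))) (at ((\<phi> \<circ> \<gamma>) t))"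
      using transition_differentiable[OF X, of V \<phi> W \<psi> "\<gamma> t"] V W
      unfolding comp_apply[of \<phi> \<gamma>] frechet_derivative_works[symmetric] by (simp add: charts_at_def)
    ultimately have D: "((\<psi> \<circ> inv_into V \<phi>) \<circ> (\<phi> \<circ> \<gamma>) has_vector_derivative
        frechet_derivative (\<psi> \<circ> inv_into V \<phi>) (at (\<phi> (\<gamma> t))) (vector_derivative (\<phi> \<circ> \<gamma>) (at t))) (at t)"
      by (rule vector_derivative_diff_chain_within[OF _ has_derivative_at_withinI])
    have "(\<psi> \<circ> \<gamma> has_vector_derivative
        frechet_derivative (\<psi> \<circ> inv_into V \<phi>) (at (\<phi> (\<gamma> t))) (vector_derivative (\<phi> \<circ> \<gamma>) (at t))) (at t)"
      using D unfolding has_vector_derivative_def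
    proof (rule has_derivative_transform_eventually)
      show "\<forall>\<^sub>F s in at t. ((\<psi> \<circ> inv_into V \<phi>) \<circ> (\<phi> \<circ> \<gamma>)) s = (\<psi> \<circ> \<gamma>) s"
        using ev[OF V] by eventually_elim (use inj in simp)
    qed (use inj V in \<open>auto simp: charts_at_def\<close>)
    then show ?thesis by (rule vector_derivative_at)
  qed
  note chain = this
  show ?thesis
    unfolding tangent_space_def velocity_def snd_conv
  proof (intro CollectI conjI ballI allI impI; clarify?)
    fix V \<phi> W \<psi> assume "(V, \<phi>) \<in> charts_at X (\<gamma> t)" "(W, \<psi>) \<in> charts_at X (\<gamma> t)"
    with chain[OF this] show "(if (W, \<psi>) \<in> charts_at X (\<gamma> t) then vector_derivative (snd (W, \<psi>) \<circ> \<gamma>) (at t) else 0) =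
      frechet_derivative (\<psi> \<circ> inv_into V \<phi>) (at (\<phi> (\<gamma> t)))
        (if (V, \<phi>) \<in> charts_at X (\<gamma> t) then vector_derivative (snd (V, \<phi>) \<circ> \<gamma>) (at t) else 0)"
      by (simp only: if_True snd_conv)
  qed simp
qed

text \<open>The vector is the velocity of the coordinate line through \<open>\<phi> q\<close> in
  direction \<open>a\<close>, so the transformation law comes from
  \<open>velocity_in_tangent_space\<close>. Existence for every \<open>a\<close> makes a Riemannian
  metric positive on the whole coordinate unit sphere.\<close>

lemma tangent_vector_exists:
  assumes X: "X \<subseteq> charts X" and c: "(V, \<phi>) \<in> X" and q: "q \<in> V"
  obtains v where "v \<in> tangent_space X q" "v (V, \<phi>) = a"
proof -
  have cm: "(V, \<phi>) \<in> charts X" using X c by blast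
  have inj: "inj_on \<phi> V" using cm charts_inj_on by blast
  have op: "open (\<phi> ` V)" using cm charts_open_image by blast
  define l where "l = (\<lambda>s::real. \<phi> q + s *\<^sub>R a)"
  define \<gamma> where "\<gamma> = inv_into V \<phi> \<circ> l"
  have l: "(l has_vector_derivative a) (at 0)"
    unfolding l_def by (auto intro!: derivative_eq_intros)
  have l0: "l 0 = \<phi> q" by (simp add: l_def)
  have \<gamma>0: "\<gamma> 0 = q" using inj q by (simp add: \<gamma>_def l0)
  have evl: "\<forall>\<^sub>F s in at 0. l s \<in> G" if "open G" "\<phi> q \<in> G" for G
  proof -
    have "(l \<longlongrightarrow> l 0) (at 0)" unfolding l_def by (auto intro!: tendsto_eq_intros)
    then show ?thesis using that by (simp add: l0 topological_tendstoD)
  qed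
  have "snd (velocity X \<gamma> 0) \<in> tangent_space X (\<gamma> 0)"
  proof (rule velocity_in_tangent_space[OF X])
    fix W \<psi> assume "(W, \<psi>) \<in> charts_at X (\<gamma> 0)"
    then have W: "(W, \<psi>) \<in> charts X" "q \<in> W" by (auto simp: charts_at_def \<gamma>0)
    have "(\<psi> \<circ> inv_into V \<phi>) differentiable (at (l 0))"
      using transition_differentiable[OF X cm W(1) q W(2)] by (simp add: l0)
    then have "((\<psi> \<circ> inv_into V \<phi>) \<circ> l) differentiable (at 0)"
      using l differentiableI_vector differentiable_chain_at by blast
    then show "(\<psi> \<circ> \<gamma>) differentiable (at 0)" by (simp add: \<gamma>_def comp_assoc)
    have "openin (top_of_set (\<phi> ` V)) {x \<in> \<phi> ` V. inv_into V \<phi> x \<in> W}"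
      using openin_continuous_map_preimage[OF continuous_map_chart_inv[OF X c] openin_chart[OF X W(1)]]
      by simp
    then have "open {x \<in> \<phi> ` V. inv_into V \<phi> x \<in> W}" using op openin_open_trans by blast
    from evl[OF this] have "\<forall>\<^sub>F s in at 0. l s \<in> {x \<in> \<phi> ` V. inv_into V \<phi> x \<in> W}"
      using q inj W by auto
    then show "\<forall>\<^sub>F s in at 0. \<gamma> s \<in> W" by eventually_elim (simp add: \<gamma>_def)
  qed
  moreover have "snd (velocity X \<gamma> 0) (V, \<phi>) = a"
  proof -
    have "(\<phi> \<circ> \<gamma> has_vector_derivative a) (at 0)"
      using l unfolding has_vector_derivative_def
    proof (rule has_derivative_transform_eventually)
      have "\<forall>\<^sub>F s in at 0. l s \<in> \<phi> ` V" using evl op q by blast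
      then show "\<forall>\<^sub>F s in at 0. l s = (\<phi> \<circ> \<gamma>) s"
        by eventually_elim (simp add: \<gamma>_def f_inv_into_f)
    qed (simp_all add: \<gamma>0 l0)
    then show ?thesis
      using cm q by (simp add: velocity_def charts_at_def \<gamma>0 vector_derivative_at)
  qed
  ultimately show ?thesis using that \<gamma>0 by metis
qed

text \<open>The transformation law makes one component determine all others, and off the charts
  around \<open>q\<close> the convention fixes the value 0; hence the tangent chart is injective.
  The smoothness clause of \<open>riemannian_metric\<close> is phrased through this inverse.\<close>

lemma tangent_chart_inverse:
  assumes c: "(V, \<phi>) \<in> charts X" and q: "q \<in> V" and v: "v \<in> tangent_space X q"
  shows "inv_into (tangent_over X V) (tangent_chart (V, \<phi>)) (\<phi> q, v (V, \<phi>)) = (q, v)"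
proof -
  have "inj_on (tangent_chart (V, \<phi>)) (tangent_over X V)"
  proof (rule inj_onI, clarify)
    fix p u p' u'
    assume u: "(p, u) \<in> tangent_over X V" and u': "(p', u') \<in> tangent_over X V"
      and eq: "tangent_chart (V, \<phi>) (p, u) = tangent_chart (V, \<phi>) (p', u')"
    have "p = p'" using eq u u' charts_inj_on[OF c]
      by (auto simp: tangent_chart_def tangent_over_def inj_on_def)
    moreover have "u d = u' d" for d
    proof (cases "d \<in> charts_at X p")
      case True
      obtain W \<psi> where d: "d = (W, \<psi>)" by (cases d)
      have "(V, \<phi>) \<in> charts_at X p" using c u by (auto simp: charts_at_def tangent_over_def)
      moreover have "u \<in> tangent_space X p" "u' \<in> tangent_space X p"
        using u u' \<open>p = p'\<close> by (auto simp: tangent_over_def)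
      ultimately have "u d = frechet_derivative (\<psi> \<circ> inv_into V \<phi>) (at (\<phi> p)) (u (V, \<phi>))"
        "u' d = frechet_derivative (\<psi> \<circ> inv_into V \<phi>) (at (\<phi> p)) (u' (V, \<phi>))"
        using True unfolding d tangent_space_def by blast+
      then show ?thesis using eq by (simp add: tangent_chart_def)
    next
      case False
      then show ?thesis
        using u u' \<open>p = p'\<close> by (cases d) (auto simp: tangent_over_def tangent_space_def)
    qed
    ultimately show "p = p' \<and> u = u'" by auto
  qed
  moreover have "(q, v) \<in> tangent_over X V" using q v by (simp add: tangent_over_def)
  moreover have "(\<phi> q, v (V, \<phi>)) = tangent_chart (V, \<phi>) (q, v)" by (simp add: tangent_chart_def)
  ultimately show ?thesis by (metis inv_into_f_f)
qed

lemma tangent_space_scale: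
  assumes X: "X \<subseteq> charts X" and v: "v \<in> tangent_space X q"
  shows "(\<lambda>d. a *\<^sub>R v d) \<in> tangent_space X q"
proof -
  have "a *\<^sub>R v (W, \<psi>) = frechet_derivative (\<psi> \<circ> inv_into V \<phi>) (at (\<phi> q)) (a *\<^sub>R v (V, \<phi>))"
    if V: "(V, \<phi>) \<in> charts_at X q" and W: "(W, \<psi>) \<in> charts_at X q" for V \<phi> W \<psi>
  proof -
    have "(\<psi> \<circ> inv_into V \<phi>) differentiable (at (\<phi> q))"
      using transition_differentiable[OF X] V W by (auto simp: charts_at_def)
    moreover have "v (W, \<psi>) = frechet_derivative (\<psi> \<circ> inv_into V \<phi>) (at (\<phi> q)) (v (V, \<phi>))"
      using v V W unfolding tangent_space_def by blast
    ultimately show ?thesis by (metis linear_frechet_derivative linear_scale)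
  qed
  then show ?thesis using v by (auto simp: tangent_space_def)
qed

section \<open>Riemannian length and coordinate distance\<close>

text \<open>In coordinates the squared norm is a continuous positive function on the compact product
  of the ball and the unit sphere, so it has a positive minimum; quadratic homogeneity extends the
  bound to all vectors.\<close>

lemma riemannian_metric_lower_bound:
  fixes X :: "('a, 'e::{real_inner,heine_borel}) atlas"
  assumes X: "X \<subseteq> charts X" and h: "riemannian_metric X h" and c: "(V, \<phi>) \<in> X"
    and b: "cball z r \<subseteq> \<phi> ` V"
  obtains m where "m > 0"
    "\<And>q v. q \<in> V \<Longrightarrow> \<phi> q \<in> cball z r \<Longrightarrow> v \<in> tangent_space X q \<Longrightarrow>
        ennreal (m * norm (v (V, \<phi>))) \<le> ennreal (tnorm h (q, v))"
proof -
  have cm: "(V, \<phi>) \<in> charts X" using X c by blast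
  have inj: "inj_on \<phi> V" using cm charts_inj_on by blast
  let ?\<tau> = "\<lambda>x a. snd (inv_into (tangent_over X V) (tangent_chart (V, \<phi>)) (x, a))"
  define H where "H = (\<lambda>(x, a, b). h (inv_into V \<phi> x) (?\<tau> x a) (?\<tau> x b))"
  have H: "H (\<phi> q, v (V, \<phi>), v (V, \<phi>)) = h q v v" if "q \<in> V" "v \<in> tangent_space X q" for q v
    using tangent_chart_inverse[OF cm that] inj that by (simp add: H_def)
  have "\<forall>(V, \<phi>)\<in>charts X. smooth_on (\<phi> ` V \<times> UNIV \<times> UNIV)
        (\<lambda>(x, a, b). h (inv_into V \<phi> x)
           (snd (inv_into (tangent_over X V) (tangent_chart (V, \<phi>)) (x, a)))
           (snd (inv_into (tangent_over X V) (tangent_chart (V, \<phi>)) (x, b))))"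
    using h unfolding riemannian_metric_def by blast
  then have "smooth_on (\<phi> ` V \<times> UNIV \<times> UNIV) H" using cm unfolding H_def by blast
  then have contH: "continuous_on (\<phi> ` V \<times> UNIV \<times> UNIV) H" by (rule smooth_on_continuous_on)
  have hpos: "h q v v > 0" if "q \<in> V" "v \<in> tangent_space X q" "v \<noteq> (\<lambda>_. 0)" for q v
  proof -
    have "q \<in> carrier X" using c that by (auto simp: carrier_def)
    then show ?thesis using h that unfolding riemannian_metric_def by blast
  qed
  have hscale: "h q (\<lambda>d. a *\<^sub>R v d) (\<lambda>d. a *\<^sub>R v d) = a\<^sup>2 * h q v v"
    if q: "q \<in> V" and v: "v \<in> tangent_space X q" for q v a
  proof -
    have qc: "q \<in> carrier X" using c that by (auto simp: carrier_def)
    have av: "(\<lambda>d. a *\<^sub>R v d) \<in> tangent_space X q" using tangent_space_scale[OF X v] .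
    have sym: "h q u w = h q w u" if "u \<in> tangent_space X q" "w \<in> tangent_space X q" for u w
      using h qc that unfolding riemannian_metric_def by blast
    \<comment> \<open>Homogeneity is read off from the joint linearity axiom with second coefficient
      0; symmetry transfers it to the other argument.\<close>
    have "h q (\<lambda>d. a *\<^sub>R v d + 0 *\<^sub>R v d) w = a * h q v w + 0 * h q v w"
      if "w \<in> tangent_space X q" for w
      using h qc v that unfolding riemannian_metric_def by blast
    then have lin: "h q (\<lambda>d. a *\<^sub>R v d) w = a * h q v w" if "w \<in> tangent_space X q" for w
      using that by simp
    show ?thesis using lin[OF av] lin[OF v] sym[OF v av] by (simp add: power2_eq_square)
  qed
  define K where "K = cball z r \<times> sphere (0::'e) 1"
  have "compact (sphere (0::'e) 1)" unfolding compact_eq_bounded_closed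
  proof
    show "bounded (sphere (0::'e) 1)" by (rule bounded_subset[OF bounded_cball sphere_cball])
    have "closed {x::'e. norm x = 1}" by (intro closed_Collect_eq continuous_intros)
    then show "closed (sphere (0::'e) 1)" by (simp add: sphere_def)
  qed
  then have compK: "compact K" unfolding K_def by (intro compact_Times compact_cball)
  define g where "g = (\<lambda>(x, a). H (x, a, a))"
  have contg: "continuous_on K g"
  proof -
    have "continuous_on K (\<lambda>y. H (fst y, snd y, snd y))"
      by (rule continuous_on_compose2[OF contH]) (use b in \<open>auto simp: K_def intro!: continuous_intros\<close>)
    then show ?thesis by (simp add: g_def case_prod_unfold)
  qed
  have gpos: "g y > 0" if yK: "y \<in> K" for y
  proof -
    obtain x a where y: "y = (x, a)" "x \<in> cball z r" "norm a = 1"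
      using yK by (cases y) (auto simp: K_def)
    then obtain q where q: "q \<in> V" "x = \<phi> q" using b by blast
    obtain v where v: "v \<in> tangent_space X q" "v (V, \<phi>) = a"
      using tangent_vector_exists[OF X c q(1)] by metis
    have "v \<noteq> (\<lambda>_. 0)" using v y by auto
    then show ?thesis using H[OF q(1) v(1)] hpos[OF q(1) v(1)] v q y by (simp add: g_def)
  qed
  \<comment> \<open>\<open>K\<close> is empty in dimension zero, where the unit sphere is empty, and
    for negative radius; any positive constant then works.\<close>
  obtain \<mu> where \<mu>: "\<mu> > 0" "\<And>y. y \<in> K \<Longrightarrow> \<mu> \<le> g y"
  proof (cases "K = {}")
    case False
    then obtain y0 where "y0 \<in> K" "\<forall>y\<in>K. g y0 \<le> g y"
      using continuous_attains_inf[OF compK _ contg] by blast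
    then show ?thesis using that gpos by blast
  qed (use that[of 1] in auto)
  show ?thesis
  proof
    show "sqrt \<mu> > 0" using \<mu> by simp
    fix q v assume q: "q \<in> V" "\<phi> q \<in> cball z r" and v: "v \<in> tangent_space X q"
    let ?a = "v (V, \<phi>)"
    show "ennreal (sqrt \<mu> * norm ?a) \<le> ennreal (tnorm h (q, v))"
    proof (cases "?a = 0")
      case False
      let ?u = "\<lambda>d. (1 / norm ?a) *\<^sub>R v d"
      have u: "?u \<in> tangent_space X q" by (rule tangent_space_scale[OF X v])
      have "(\<phi> q, ?u (V, \<phi>)) \<in> K" using q False by (simp add: K_def)
      then have "\<mu> \<le> g (\<phi> q, ?u (V, \<phi>))" by (rule \<mu>)
      also have "\<dots> = h q ?u ?u" using H[OF q(1) u] by (simp only: g_def prod.case)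
      also have "\<dots> = (1 / norm ?a)\<^sup>2 * h q v v" by (rule hscale[OF q(1) v])
      finally have "\<mu> * (norm ?a)\<^sup>2 \<le> h q v v"
        using False by (simp add: divide_simps power_divide split: if_splits)
      then have "sqrt (\<mu> * (norm ?a)\<^sup>2) \<le> sqrt (h q v v)" by (rule real_sqrt_le_mono)
      then have "sqrt \<mu> * norm ?a \<le> tnorm h (q, v)"
        by (simp add: real_sqrt_mult tnorm_def)
      then show ?thesis by (rule ennreal_leI)
    qed simp
  qed
qed

text \<open>The derivative need not be Lebesgue integrable and \<open>g\<close> need not be
  measurable. The gauge integral recovers the increment regardless; afterwards the positive part
  counts, whose integral is either infinite, which makes the claim trivial, or finite, which permits
  comparison in the Lebesgue sense.\<close>

lemma real_increment_le_nn_integral: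
  fixes f f' :: "real \<Rightarrow> real"
  assumes S: "finite S" and ab: "a \<le> b" and cont: "continuous_on {a..b} f"
    and deriv: "\<And>x. x \<in> {a<..<b} - S \<Longrightarrow> (f has_real_derivative f' x) (at x)"
    and le: "\<And>x. x \<in> {a<..<b} - S \<Longrightarrow> ennreal (f' x) \<le> g x"
  shows "ennreal (f b - f a) \<le> (\<integral>\<^sup>+x. g x * indicator {a..b} x \<partial>lborel)"
proof -
  have I: "(f' has_integral (f b - f a)) {a..b}"
    by (rule fundamental_theorem_of_calculus_interior_strong[OF S ab])
      (use deriv cont in \<open>auto simp: has_real_derivative_iff_has_vector_derivative\<close>)
  \<comment> \<open>Setting the integrand to 0 off the good points changes it inside the interval
    only on a finite set and makes the comparison with \<open>g\<close> valid everywhere.\<close>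
  define F where "F = (\<lambda>x. if x \<in> {a<..<b} - S then f' x else 0)"
  have neg: "negligible (insert a (insert b S))" using S by (simp add: negligible_finite)
  have IF: "(F has_integral (f b - f a)) {a..b}"
    by (rule has_integral_spike[OF neg _ I]) (auto simp: F_def)
  then have IU: "(F has_integral (f b - f a)) UNIV"
    by (rule has_integral_on_superset) (auto simp: F_def)
  have meas: "F \<in> borel_measurable lebesgue"
    using has_integral_implies_lebesgue_measurable[OF IU] by simp
  have "ennreal (f b - f a) \<le> (\<integral>\<^sup>+x. ennreal (F x) \<partial>lebesgue)"
  proof (cases "(\<integral>\<^sup>+x. ennreal (F x) \<partial>lebesgue) = \<infinity>")
    case False
    let ?P = "\<lambda>x. max 0 (F x)"
    have P: "integrable lebesgue ?P"
    proof (rule integrableI_bounded)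
      show "?P \<in> borel_measurable lebesgue" using meas by measurable
      have "(\<integral>\<^sup>+x. ennreal (norm (?P x)) \<partial>lebesgue) = (\<integral>\<^sup>+x. ennreal (F x) \<partial>lebesgue)"
        by (intro nn_integral_cong) (auto simp: max_def ennreal_neg)
      then show "(\<integral>\<^sup>+x. ennreal (norm (?P x)) \<partial>lebesgue) < \<infinity>" using False by (simp add: top.not_eq_extremum)
    qed
    have "(?P has_integral (\<integral>x. ?P x \<partial>lebesgue)) UNIV"
      using has_integral_integral_lebesgue[OF P] .
    then have "f b - f a \<le> (\<integral>x. ?P x \<partial>lebesgue)"
      by (rule has_integral_le[OF IU]) auto
    then have "ennreal (f b - f a) \<le> ennreal (\<integral>x. ?P x \<partial>lebesgue)" by (rule ennreal_leI)
    also have "\<dots> = (\<integral>\<^sup>+x. ennreal (?P x) \<partial>lebesgue)"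
      using P by (intro nn_integral_eq_integral[symmetric]) auto
    also have "\<dots> = (\<integral>\<^sup>+x. ennreal (F x) \<partial>lebesgue)"
      by (intro nn_integral_cong) (auto simp: max_def ennreal_neg)
    finally show ?thesis .
  qed simp
  also have "\<dots> = (\<integral>\<^sup>+x. ennreal (F x) \<partial>lborel)" by (rule nn_integral_completion)
  also have "\<dots> \<le> (\<integral>\<^sup>+x. g x * indicator {a..b} x \<partial>lborel)"
    by (intro nn_integral_mono) (use le in \<open>auto simp: F_def indicator_def\<close>)
  finally show ?thesis .
qed

text \<open>Projecting onto the direction \<open>e\<close> of the total increment reduces to
  real-valued functions: the increment loses nothing, and by Cauchy-Schwarz the derivative does not
  grow.\<close>

lemma norm_increment_le_nn_integral:
  fixes f :: "real \<Rightarrow> 'e::real_inner"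
  assumes S: "finite S" and ab: "a \<le> b" and cont: "continuous_on {a..b} f" and m: "m \<ge> 0"
    and deriv: "\<And>x. x \<in> {a<..<b} - S \<Longrightarrow> (f has_vector_derivative f' x) (at x)"
    and le: "\<And>x. x \<in> {a<..<b} - S \<Longrightarrow> ennreal (m * norm (f' x)) \<le> g x"
  shows "ennreal (m * norm (f b - f a)) \<le> (\<integral>\<^sup>+x. g x * indicator {a..b} x \<partial>lborel)"
proof (cases "f b = f a")
  case False
  define e where "e = (1 / norm (f b - f a)) *\<^sub>R (f b - f a)"
  have ne: "norm e = 1" using False by (simp add: e_def)
  have ie: "(f b - f a) \<bullet> e = norm (f b - f a)"
    using False by (simp add: e_def dot_square_norm power2_eq_square)
  have "ennreal (m * (f b \<bullet> e) - m * (f a \<bullet> e)) \<le> (\<integral>\<^sup>+x. g x * indicator {a..b} x \<partial>lborel)"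
  proof (rule real_increment_le_nn_integral[OF S ab, where f' = "\<lambda>x. m * (f' x \<bullet> e)"])
    show "continuous_on {a..b} (\<lambda>x. m * (f x \<bullet> e))" by (intro continuous_intros cont)
    fix x assume x: "x \<in> {a<..<b} - S"
    have "(f has_derivative (\<lambda>t. t *\<^sub>R f' x)) (at x)"
      using deriv[OF x] by (simp add: has_vector_derivative_def)
    then have "((\<lambda>x. m * (f x \<bullet> e)) has_derivative (\<lambda>t. m * ((t *\<^sub>R f' x) \<bullet> e))) (at x)"
      by (intro has_derivative_mult_right has_derivative_inner_left)
    then show "((\<lambda>x. m * (f x \<bullet> e)) has_real_derivative m * (f' x \<bullet> e)) (at x)"
      unfolding has_field_derivative_def by (rule has_derivative_eq_rhs) (auto simp: mult_ac)
    have "f' x \<bullet> e \<le> norm (f' x)" using norm_cauchy_schwarz[of "f' x" e] ne by simp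
    then have "ennreal (m * (f' x \<bullet> e)) \<le> ennreal (m * norm (f' x))"
      using m by (intro ennreal_leI mult_left_mono)
    then show "ennreal (m * (f' x \<bullet> e)) \<le> g x" using le[OF x] by (rule order_trans)
  qed
  then show ?thesis by (simp add: ie inner_diff_left[symmetric] right_diff_distrib[symmetric])
qed simp

section \<open>Piecewise smooth curves in charts\<close>

lemma openin_open_atlas: "openin (mtop (open_atlas U)) S \<longleftrightarrow> S \<subseteq> U \<and> open (S \<inter> U)"
  using openin_mtop_inj[of "open_atlas U" S] by (auto simp: open_atlas_def carrier_def)

lemma open_atlas_chart: "open U \<Longrightarrow> (U, \<lambda>x. x) \<in> charts (open_atlas U)"
proof -
  assume U: "open U"
  have "smooth_on U ((\<lambda>x. x) \<circ> inv_into U (\<lambda>x. x))"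
  proof (rule smooth_on_cong_open[OF U _ smooth_on_id])
    fix x assume "x \<in> U"
    then show "x = ((\<lambda>x. x) \<circ> inv_into U (\<lambda>x. x)) x" using f_inv_into_f[of x "\<lambda>x. x" U] by simp
  qed
  then show ?thesis using U by (auto simp: charts_def open_atlas_def carrier_def compatible_def)
qed

lemma smooth_curve_chart:
  assumes U: "open (U::real set)" and \<delta>: "smooth_map (open_atlas U) X \<delta>" and X: "X \<subseteq> charts X"
    and t: "t \<in> U" and c: "(W, \<psi>) \<in> charts X" "\<delta> t \<in> W"
  shows "\<exists>G. open G \<and> t \<in> G \<and> \<delta> ` G \<subseteq> W" "(\<psi> \<circ> \<delta>) differentiable (at t)"
proof -
  have cont: "continuous_map (mtop (open_atlas U)) (mtop X) \<delta>"
    and sm: "smooth_on ((\<lambda>x. x) ` (U \<inter> \<delta> -` W)) (\<psi> \<circ> \<delta> \<circ> inv_into U (\<lambda>x. x))"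
    using \<delta> open_atlas_chart[OF U] c unfolding smooth_map_def by blast+
  have top: "topspace (mtop (open_atlas U)) = U"
    using openin_open_atlas[of U U] openin_open_atlas[of U "topspace (mtop (open_atlas U))"] U
      openin_subset[of "mtop (open_atlas U)" U] by auto
  have "openin (mtop (open_atlas U)) {x \<in> topspace (mtop (open_atlas U)). \<delta> x \<in> W}"
    using openin_continuous_map_preimage[OF cont openin_chart[OF X c(1)]] .
  moreover have "{x \<in> topspace (mtop (open_atlas U)). \<delta> x \<in> W} = U \<inter> \<delta> -` W" using top by auto
  ultimately have op: "open (U \<inter> \<delta> -` W)" by (simp add: openin_open_atlas Int_absorb2)
  then show "\<exists>G. open G \<and> t \<in> G \<and> \<delta> ` G \<subseteq> W" using t c by (intro exI[of _ "U \<inter> \<delta> -` W"]) auto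
  have "(\<psi> \<circ> \<delta> \<circ> inv_into U (\<lambda>x. x)) differentiable (at t)"
    using smooth_on_differentiable[OF sm] t c by simp
  then obtain D where D: "(\<psi> \<circ> \<delta> \<circ> inv_into U (\<lambda>x. x) has_derivative D) (at t)"
    unfolding differentiable_def by blast
  have "(\<psi> \<circ> \<delta> has_derivative D) (at t)"
  proof (rule has_derivative_transform_within_open[OF D U t])
    fix x assume "x \<in> U"
    then show "(\<psi> \<circ> \<delta> \<circ> inv_into U (\<lambda>x. x)) x = (\<psi> \<circ> \<delta>) x"
      using f_inv_into_f[of x "\<lambda>x. x" U] by simp
  qed
  then show "(\<psi> \<circ> \<delta>) differentiable (at t)" unfolding differentiable_def by blast
qed

text \<open>Consecutive entries may coincide, but \<open>hd ts < last ts\<close> excludes the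
  one-element list, which has no interval to offer.\<close>

lemma sorted_list_covers:
  assumes "sorted ts" "ts \<noteq> []" "hd ts < last ts" "hd ts \<le> (x::real)" "x \<le> last ts"
  shows "\<exists>i. Suc i < length ts \<and> ts ! i \<le> x \<and> x \<le> ts ! Suc i"
  using assms
proof (induction ts)
  case (Cons a ts)
  then have ne: "ts \<noteq> []" by auto
  show ?case
  proof (cases "x \<le> hd ts")
    case True
    then show ?thesis using Cons.prems ne by (intro exI[of _ 0]) (auto simp: hd_conv_nth)
  next
    case False
    then have "hd ts < last ts" using Cons.prems ne by simp
    then obtain i where "Suc i < length ts" "ts ! i \<le> x" "x \<le> ts ! Suc i"
      using Cons ne False by auto
    then show ?thesis by (intro exI[of _ "Suc i"]) auto
  qed
qed simp

lemma piecewise_smooth_cover: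
  assumes "piecewise_smooth X \<gamma>"
  obtains ts where "\<And>x. 0 \<le> x \<Longrightarrow> x \<le> 1 \<Longrightarrow>
      \<exists>i. Suc i < length ts \<and> ts ! i \<le> x \<and> x \<le> ts ! Suc i"
    "\<And>i. Suc i < length ts \<Longrightarrow> smooth_arc X \<gamma> (ts ! i) (ts ! Suc i)"
    "\<And>i. i < length ts \<Longrightarrow> 0 \<le> ts ! i \<and> ts ! i \<le> 1"
proof -
  obtain ts where ts: "ts \<noteq> []" "sorted ts" "hd ts = 0" "last ts = 1"
    and arc: "\<And>i. Suc i < length ts \<Longrightarrow> smooth_arc X \<gamma> (ts ! i) (ts ! Suc i)"
    using assms unfolding piecewise_smooth_def by blast
  show ?thesis
  proof (rule that)
    show "\<exists>i. Suc i < length ts \<and> ts ! i \<le> x \<and> x \<le> ts ! Suc i" if "0 \<le> x" "x \<le> 1" for x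
      using sorted_list_covers[of ts x] ts that by simp
    show "0 \<le> ts ! i \<and> ts ! i \<le> 1" if "i < length ts" for i
      using sorted_nth_mono[OF ts(2), of 0 i] sorted_nth_mono[OF ts(2), of i "length ts - 1"] that ts
      by (simp add: hd_conv_nth last_conv_nth)
  qed (fact arc)
qed

lemma smooth_arc_continuous_map:
  assumes X: "X \<subseteq> charts X" and "smooth_arc X \<gamma> a b"
  shows "continuous_map (top_of_set {a..b}) (mtop X) \<gamma>"
proof -
  obtain U \<delta> where U: "open U" "{a..b} \<subseteq> U" and \<delta>: "smooth_map (open_atlas U) X \<delta>"
    and eq: "\<And>t. t \<in> {a..b} \<Longrightarrow> \<gamma> t = \<delta> t"
    using assms unfolding smooth_arc_def by blast
  have cont: "continuous_map (mtop (open_atlas U)) (mtop X) \<delta>" using \<delta> by (simp add: smooth_map_def)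
  have "mtop (open_atlas U) = top_of_set U"
    unfolding topology_eq using U by (auto simp: openin_open_atlas openin_open_eq Int_absorb2)
  then have "continuous_map (top_of_set {a..b}) (mtop X) \<delta>"
    using cont U continuous_map_from_subtopology_mono by metis
  then show ?thesis by (rule continuous_map_eq) (use eq in auto)
qed

text \<open>Pasting along finitely many closed intervals: the preimage of a closed set is the finite
  union of its closed pieces.\<close>

lemma piecewise_smooth_continuous_map:
  assumes X: "X \<subseteq> charts X" and \<gamma>: "piecewise_smooth X \<gamma>"
  shows "continuous_map (top_of_set {0..1}) (mtop X) \<gamma>"
proof -
  obtain ts where cov: "\<And>x. 0 \<le> x \<Longrightarrow> x \<le> 1 \<Longrightarrow>
      \<exists>i. Suc i < length ts \<and> ts ! i \<le> x \<and> x \<le> ts ! Suc i"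
    and arc: "\<And>i. Suc i < length ts \<Longrightarrow> smooth_arc X \<gamma> (ts ! i) (ts ! Suc i)"
    and rng: "\<And>i. i < length ts \<Longrightarrow> 0 \<le> ts ! i \<and> ts ! i \<le> 1"
    using piecewise_smooth_cover[OF \<gamma>] by metis
  have cont: "continuous_map (top_of_set {ts ! i..ts ! Suc i}) (mtop X) \<gamma>" if "Suc i < length ts" for i
    using smooth_arc_continuous_map[OF X arc[OF that]] .
  show ?thesis
    unfolding continuous_map_closedin
  proof (intro conjI allI impI)
    show "\<gamma> \<in> topspace (top_of_set {0..1}) \<rightarrow> topspace (mtop X)"
    proof
      fix x assume "x \<in> topspace (top_of_set {0..1::real})"
      then obtain i where i: "Suc i < length ts" "ts ! i \<le> x" "x \<le> ts ! Suc i" using cov by auto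
      then show "\<gamma> x \<in> topspace (mtop X)"
        using continuous_map_image_subset_topspace[OF cont[OF i(1)]] by auto
    qed
    fix C assume C: "closedin (mtop X) C"
    have cl: "closed {x \<in> {ts ! i..ts ! Suc i}. \<gamma> x \<in> C}" if "Suc i < length ts" for i
      using closedin_continuous_map_preimage[OF cont[OF that] C]
        closedin_closed_trans[OF _ closed_atLeastAtMost] by simp
    have "{x \<in> topspace (top_of_set {0..1}). \<gamma> x \<in> C} =
        (\<Union>i\<in>{i. Suc i < length ts}. {x \<in> {ts ! i..ts ! Suc i}. \<gamma> x \<in> C})"
    proof (intro equalityI subsetI)
      fix x assume x: "x \<in> {x \<in> topspace (top_of_set {0..1}). \<gamma> x \<in> C}"
      then obtain i where "Suc i < length ts" "ts ! i \<le> x" "x \<le> ts ! Suc i" using cov by auto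
      then show "x \<in> (\<Union>i\<in>{i. Suc i < length ts}. {x \<in> {ts ! i..ts ! Suc i}. \<gamma> x \<in> C})"
        using x by auto
    next
      fix x assume "x \<in> (\<Union>i\<in>{i. Suc i < length ts}. {x \<in> {ts ! i..ts ! Suc i}. \<gamma> x \<in> C})"
      then obtain i where i: "Suc i < length ts" "ts ! i \<le> x" "x \<le> ts ! Suc i" "\<gamma> x \<in> C" by auto
      have "0 \<le> ts ! i" "ts ! Suc i \<le> 1" using rng i(1) by auto
      then show "x \<in> {x \<in> topspace (top_of_set {0..1}). \<gamma> x \<in> C}" using i by simp
    qed
    moreover have "closed (\<Union>i\<in>{i. Suc i < length ts}. {x \<in> {ts ! i..ts ! Suc i}. \<gamma> x \<in> C})"
    proof (rule closed_UN)
      show "finite {i. Suc i < length ts}" by (rule finite_subset[of _ "{..<length ts}"]) auto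
    qed (use cl in blast)
    ultimately show "closedin (top_of_set {0..1}) {x \<in> topspace (top_of_set {0..1}). \<gamma> x \<in> C}"
      by (metis (no_types, lifting) closed_subset mem_Collect_eq subsetI topspace_euclidean_subtopology)
  qed
qed

text \<open>The exceptional set consists of the break points, including 0 and 1. Elsewhere the curve
  agrees on an open interval with a smooth one, so two-sided derivatives exist.\<close>

lemma piecewise_smooth_velocity:
  assumes X: "X \<subseteq> charts X" and \<gamma>: "piecewise_smooth X \<gamma>"
  obtains S where "finite S"
    "\<And>t. t \<in> {0..1} - S \<Longrightarrow> snd (velocity X \<gamma> t) \<in> tangent_space X (\<gamma> t)"
    "\<And>t V \<phi>. t \<in> {0..1} - S \<Longrightarrow> (V, \<phi>) \<in> charts X \<Longrightarrow> \<gamma> t \<in> V \<Longrightarrow>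
       (\<phi> \<circ> \<gamma> has_vector_derivative snd (velocity X \<gamma> t) (V, \<phi>)) (at t)"
proof -
  obtain ts where cov: "\<And>x. 0 \<le> x \<Longrightarrow> x \<le> 1 \<Longrightarrow>
      \<exists>i. Suc i < length ts \<and> ts ! i \<le> x \<and> x \<le> ts ! Suc i"
    and arc: "\<And>i. Suc i < length ts \<Longrightarrow> smooth_arc X \<gamma> (ts ! i) (ts ! Suc i)"
    using piecewise_smooth_cover[OF \<gamma>] by metis
  have loc: "(\<phi> \<circ> \<gamma>) differentiable (at t) \<and> (\<forall>\<^sub>F s in at t. \<gamma> s \<in> V)"
    if t: "t \<in> {0..1} - set ts" and c: "(V, \<phi>) \<in> charts X" "\<gamma> t \<in> V" for t V \<phi>
  proof -
    obtain i where i: "Suc i < length ts" "ts ! i \<le> t" "t \<le> ts ! Suc i" using cov t by force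
    moreover have "ts ! i \<in> set ts" "ts ! Suc i \<in> set ts" using i by auto
    ultimately have ti: "t \<in> {ts ! i<..<ts ! Suc i}" using t by (auto simp: order_less_le)
    obtain U \<delta> where U: "open U" "{ts ! i..ts ! Suc i} \<subseteq> U" and \<delta>: "smooth_map (open_atlas U) X \<delta>"
      and eq: "\<And>t. t \<in> {ts ! i..ts ! Suc i} \<Longrightarrow> \<gamma> t = \<delta> t"
      using arc[OF i(1)] unfolding smooth_arc_def by blast
    have tU: "t \<in> U" and \<delta>t: "\<delta> t \<in> V" using U ti eq[of t] c by auto
    obtain G where G: "open G" "t \<in> G" "\<delta> ` G \<subseteq> V"
      using smooth_curve_chart(1)[OF U(1) \<delta> X tU c(1) \<delta>t] by blast
    obtain D where D: "(\<phi> \<circ> \<delta> has_derivative D) (at t)"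
      using smooth_curve_chart(2)[OF U(1) \<delta> X tU c(1) \<delta>t] unfolding differentiable_def by blast
    have "(\<phi> \<circ> \<gamma> has_derivative D) (at t)"
      by (rule has_derivative_transform_within_open[OF D open_greaterThanLessThan ti]) (use eq in auto)
    moreover have "\<forall>\<^sub>F s in at t. s \<in> G \<inter> {ts ! i<..<ts ! Suc i}"
      using eventually_at_topological G ti by (metis IntI open_Int open_greaterThanLessThan)
    then have "\<forall>\<^sub>F s in at t. \<gamma> s \<in> V" by eventually_elim (use G eq in auto)
    ultimately show ?thesis unfolding differentiable_def by blast
  qed
  show ?thesis
  proof (rule that[of "set ts"])
    fix t assume t: "t \<in> {0..1} - set ts"
    show "snd (velocity X \<gamma> t) \<in> tangent_space X (\<gamma> t)"
      by (rule velocity_in_tangent_space[OF X]) (use loc[OF t] in \<open>auto simp: charts_at_def\<close>)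
    fix V \<phi> assume c: "(V, \<phi>) \<in> charts X" "\<gamma> t \<in> V"
    then have "snd (velocity X \<gamma> t) (V, \<phi>) = vector_derivative (\<phi> \<circ> \<gamma>) (at t)"
      by (simp add: velocity_def charts_at_def)
    then show "(\<phi> \<circ> \<gamma> has_vector_derivative snd (velocity X \<gamma> t) (V, \<phi>)) (at t)"
      using loc[OF t c] vector_derivative_works by metis
  qed simp
qed

text \<open>Inside the ball the Riemannian speed dominates \<open>m\<close> times the coordinate
  speed. Integrating over \<open>{a..b}\<close> gives at most the full length, as the integrand is
  nonnegative.\<close>

lemma curve_length_lower_bound:
  fixes X :: "('a, 'e::{real_inner,heine_borel}) atlas"
  assumes X: "X \<subseteq> charts X" and c: "(V, \<phi>) \<in> X" and m: "m \<ge> 0"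
    and low: "\<And>q v. q \<in> V \<Longrightarrow> \<phi> q \<in> cball z r \<Longrightarrow> v \<in> tangent_space X q \<Longrightarrow>
        ennreal (m * norm (v (V, \<phi>))) \<le> ennreal (tnorm h (q, v))"
    and \<gamma>: "piecewise_smooth X \<gamma>" and ab: "0 \<le> a" "a \<le> b" "b \<le> 1"
    and sub: "\<gamma> ` {a..b} \<subseteq> V \<inter> \<phi> -` cball z r"
  shows "ennreal (m * dist (\<phi> (\<gamma> b)) (\<phi> (\<gamma> a))) \<le> curve_length X h \<gamma>"
proof -
  have cm: "(V, \<phi>) \<in> charts X" using X c by blast
  obtain S where S: "finite S"
    and tan: "\<And>t. t \<in> {0..1} - S \<Longrightarrow> snd (velocity X \<gamma> t) \<in> tangent_space X (\<gamma> t)"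
    and der: "\<And>t V \<phi>. t \<in> {0..1} - S \<Longrightarrow> (V, \<phi>) \<in> charts X \<Longrightarrow> \<gamma> t \<in> V \<Longrightarrow>
       (\<phi> \<circ> \<gamma> has_vector_derivative snd (velocity X \<gamma> t) (V, \<phi>)) (at t)"
    using piecewise_smooth_velocity[OF X \<gamma>] by metis
  have "continuous_map (top_of_set {a..b}) (mtop X) \<gamma>"
    by (rule continuous_map_from_subtopology_mono[OF piecewise_smooth_continuous_map[OF X \<gamma>]])
      (use ab in auto)
  then have "continuous_map (top_of_set {a..b}) (subtopology (mtop X) V) \<gamma>"
    using sub by (auto simp: continuous_map_in_subtopology)
  from continuous_map_compose[OF this continuous_map_chart[OF X cm]]
  have cont: "continuous_on {a..b} (\<phi> \<circ> \<gamma>)" by simp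
  have "ennreal (m * norm ((\<phi> \<circ> \<gamma>) b - (\<phi> \<circ> \<gamma>) a)) \<le>
      (\<integral>\<^sup>+t. ennreal (tnorm h (velocity X \<gamma> t)) * indicator {a..b} t \<partial>lborel)"
  proof (rule norm_increment_le_nn_integral[OF S ab(2) cont m])
    fix t assume t: "t \<in> {a<..<b} - S"
    then have "t \<in> {a..b}" by auto
    then have "\<gamma> t \<in> V \<inter> \<phi> -` cball z r" using sub by blast
    with t ab have t': "t \<in> {0..1} - S" "\<gamma> t \<in> V" "\<phi> (\<gamma> t) \<in> cball z r" by auto
    show "(\<phi> \<circ> \<gamma> has_vector_derivative snd (velocity X \<gamma> t) (V, \<phi>)) (at t)"
      by (rule der[OF t'(1) cm t'(2)])
    show "ennreal (m * norm (snd (velocity X \<gamma> t) (V, \<phi>))) \<le> ennreal (tnorm h (velocity X \<gamma> t))"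
      using low[OF t'(2,3) tan[OF t'(1)]] by (simp add: velocity_def)
  qed
  also have "\<dots> \<le> curve_length X h \<gamma>"
    unfolding curve_length_def by (intro nn_integral_mono) (use ab in \<open>auto simp: indicator_def\<close>)
  finally show ?thesis by (simp add: dist_norm)
qed

text \<open>A curve shorter than \<open>m * r\<close> moves less than r in coordinates while it
  stays in the doubled ball, so it never leaves it. Either endpoint may be the one near the centre,
  because limits have to be transferred between two nets in both directions.\<close>

lemma riem_dist_coordinates:
  fixes X :: "('a, 'e::{real_inner,heine_borel}) atlas"
  assumes man: "smooth_manifold X" and h: "riemannian_metric X h" and c: "(V, \<phi>) \<in> X"
    and r: "r > 0" and b: "cball z (2 * r) \<subseteq> \<phi> ` V"
  obtains m where "m > 0"
    "\<And>x y. x \<in> V \<and> dist (\<phi> x) z < r \<or> y \<in> V \<and> dist (\<phi> y) z < r \<Longrightarrow>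
        riem_dist X h x y < ennreal (m * r) \<Longrightarrow>
        x \<in> V \<and> y \<in> V \<and> dist (\<phi> x) z < 2 * r \<and> dist (\<phi> y) z < 2 * r \<and>
        ennreal (m * dist (\<phi> x) (\<phi> y)) \<le> riem_dist X h x y"
proof -
  have X: "X \<subseteq> charts X" using man by (rule smooth_manifold_charts)
  obtain m where m: "m > 0" and low: "\<And>q v. q \<in> V \<Longrightarrow> \<phi> q \<in> cball z (2 * r) \<Longrightarrow>
      v \<in> tangent_space X q \<Longrightarrow> ennreal (m * norm (v (V, \<phi>))) \<le> ennreal (tnorm h (q, v))"
    by (rule riemannian_metric_lower_bound[OF X h c b]) (rule that)
  have bound: "ennreal (m * dist (\<phi> (\<gamma> b)) (\<phi> (\<gamma> a))) \<le> curve_length X h \<gamma>"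
    if \<gamma>: "piecewise_smooth X \<gamma>" "0 \<le> a" "a \<le> b" "b \<le> 1" "\<gamma> ` {a..b} \<subseteq> V \<inter> \<phi> -` cball z (2 * r)"
    for \<gamma> a b
  proof (rule curve_length_lower_bound[OF X c less_imp_le[OF m] _ \<gamma>])
    show "ennreal (m * norm (v (V, \<phi>))) \<le> ennreal (tnorm h (q, v))"
      if "q \<in> V" "\<phi> q \<in> cball z (2 * r)" "v \<in> tangent_space X q" for q v
      by (rule low[OF that])
  qed
  have stay: "\<gamma> ` {0..1} \<subseteq> V \<inter> \<phi> -` ball z (2 * r)"
    if \<gamma>: "piecewise_smooth X \<gamma>" and len: "curve_length X h \<gamma> < ennreal (m * r)"
      and start: "\<gamma> 0 \<in> V \<and> dist (\<phi> (\<gamma> 0)) z < r \<or> \<gamma> 1 \<in> V \<and> dist (\<phi> (\<gamma> 1)) z < r" for \<gamma>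
  proof -
    have near: "dist (\<phi> (\<gamma> t)) (\<phi> (\<gamma> s)) < r"
      if "0 \<le> s" "s \<le> t" "t \<le> 1" "\<gamma> ` {s..t} \<subseteq> V \<inter> \<phi> -` cball z (2 * r)" for s t
    proof -
      have "ennreal (m * dist (\<phi> (\<gamma> t)) (\<phi> (\<gamma> s))) < ennreal (m * r)"
        using bound[OF \<gamma> that] len by (simp add: order_le_less_trans)
      then show ?thesis using m r by (simp add: ennreal_less_iff)
    qed
    have cont: "continuous_map (top_of_set {0..1}) (mtop X) \<gamma>"
      by (rule piecewise_smooth_continuous_map[OF X \<gamma>])
    from start show ?thesis
    proof
      assume s: "\<gamma> 0 \<in> V \<and> dist (\<phi> (\<gamma> 0)) z < r"
      show ?thesis
        by (rule exit_coordinate_ball[OF man c b cont]) (use s near[of 0] in auto)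
    next
      assume s: "\<gamma> 1 \<in> V \<and> dist (\<phi> (\<gamma> 1)) z < r"
      \<comment> \<open>If the near endpoint is the terminal one, the same argument runs along the
        reversed curve; the estimate is taken on the matching piece \<open>{1 - T..1}\<close> of the
        original.\<close>
      let ?\<rho> = "\<lambda>t. \<gamma> (1 - t)"
      have "continuous_map (top_of_set {0..1::real}) (top_of_set {0..1}) (\<lambda>t. 1 - t)"
        by (auto simp: continuous_map_in_subtopology intro!: continuous_intros)
      then have "continuous_map (top_of_set {0..1}) (mtop X) ?\<rho>"
        by (rule continuous_map_compose[OF _ cont, unfolded comp_def])
      then have "?\<rho> ` {0..1} \<subseteq> V \<inter> \<phi> -` ball z (2 * r)"
      proof (rule exit_coordinate_ball[OF man c b])
        fix T :: real assume T: "0 \<le> T" "T \<le> 1" "?\<rho> ` {0..T} \<subseteq> V \<inter> \<phi> -` cball z (2 * r)"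
        have "\<gamma> t \<in> V \<inter> \<phi> -` cball z (2 * r)" if "t \<in> {1 - T..1}" for t
          using T(3) that image_eqI[of "\<gamma> t" ?\<rho> "1 - t" "{0..T}"] by auto
        then show "dist (\<phi> (?\<rho> T)) (\<phi> (?\<rho> 0)) < r"
          using near[of "1 - T" 1] T by (force simp: dist_commute)
      qed (use s in auto)
      moreover have "?\<rho> ` {0..1} = \<gamma> ` {0..1}"
      proof -
        have "(\<lambda>t::real. 1 - t) ` {0..1} = {0..1}" by (simp add: image_diff_atLeastAtMost)
        then show ?thesis using image_image[of \<gamma> "\<lambda>t. 1 - t" "{0..1}"] by simp
      qed
      ultimately show ?thesis by simp
    qed
  qed
  have ends: "x \<in> V \<and> y \<in> V \<and> dist (\<phi> x) z < 2 * r \<and> dist (\<phi> y) z < 2 * r \<and>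
      ennreal (m * dist (\<phi> x) (\<phi> y)) \<le> curve_length X h \<gamma>"
    if \<gamma>: "piecewise_smooth X \<gamma>" "\<gamma> 0 = x" "\<gamma> 1 = y"
      and len: "curve_length X h \<gamma> < ennreal (m * r)"
      and start: "x \<in> V \<and> dist (\<phi> x) z < r \<or> y \<in> V \<and> dist (\<phi> y) z < r" for \<gamma> x y
  proof -
    have st: "\<gamma> ` {0..1} \<subseteq> V \<inter> \<phi> -` ball z (2 * r)" using stay[OF \<gamma>(1) len] start \<gamma> by simp
    have "\<gamma> 0 \<in> \<gamma> ` {0..1}" "\<gamma> 1 \<in> \<gamma> ` {0..1}" by auto
    then have "x \<in> V \<inter> \<phi> -` ball z (2 * r)" "y \<in> V \<inter> \<phi> -` ball z (2 * r)" using st \<gamma> by blast+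
    moreover have "\<gamma> ` {0..1} \<subseteq> V \<inter> \<phi> -` cball z (2 * r)" using st by auto
    then have "ennreal (m * dist (\<phi> (\<gamma> 1)) (\<phi> (\<gamma> 0))) \<le> curve_length X h \<gamma>"
      using bound[OF \<gamma>(1), of 0 1] by simp
    ultimately show ?thesis using \<gamma> by (auto simp: dist_commute)
  qed
  show ?thesis
  proof (rule that[OF m])
    fix x y
    assume start: "x \<in> V \<and> dist (\<phi> x) z < r \<or> y \<in> V \<and> dist (\<phi> y) z < r"
      and d: "riem_dist X h x y < ennreal (m * r)"
    let ?\<Gamma> = "{\<gamma>. piecewise_smooth X \<gamma> \<and> \<gamma> 0 = x \<and> \<gamma> 1 = y}"
    from d obtain \<gamma> where "\<gamma> \<in> ?\<Gamma>" "curve_length X h \<gamma> < ennreal (m * r)"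
      unfolding riem_dist_def INF_less_iff by blast
    then have *: "x \<in> V \<and> y \<in> V \<and> dist (\<phi> x) z < 2 * r \<and> dist (\<phi> y) z < 2 * r \<and>
        ennreal (m * dist (\<phi> x) (\<phi> y)) \<le> curve_length X h \<gamma>" "curve_length X h \<gamma> < ennreal (m * r)"
      using ends start by auto
    have "ennreal (m * dist (\<phi> x) (\<phi> y)) \<le> riem_dist X h x y"
      unfolding riem_dist_def
    proof (rule INF_greatest)
      \<comment> \<open>One short curve already shows
        \<open>m * dist (\<phi> x) (\<phi> y) < m * r\<close>, so competitors of length at least
        \<open>m * r\<close> satisfy the bound trivially.\<close>
      fix \<gamma>' assume "\<gamma>' \<in> ?\<Gamma>"
      then show "ennreal (m * dist (\<phi> x) (\<phi> y)) \<le> curve_length X h \<gamma>'"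
        using ends[of \<gamma>' x y] start * by (cases "curve_length X h \<gamma>' < ennreal (m * r)") (auto simp: not_less)
    qed
    then show "x \<in> V \<and> y \<in> V \<and> dist (\<phi> x) z < 2 * r \<and> dist (\<phi> y) z < 2 * r \<and>
        ennreal (m * dist (\<phi> x) (\<phi> y)) \<le> riem_dist X h x y"
      using * by blast
  qed
qed

section \<open>Limits along nets\<close>

text \<open>Smallness of a Riemannian distance is converted into a statement about the topology, so
  later arguments need not compare the metrics of different witnesses. Whichever net converges,
  \<open>riem_dist_coordinates\<close> pulls the other one into the chart.\<close>

lemma riem_dist_limitin:
  fixes X :: "('a, 'e::{real_inner,heine_borel}) atlas"
  assumes man: "smooth_manifold X" and h: "riemannian_metric X h"
    and d: "((\<lambda>\<epsilon>. riem_dist X h (f \<epsilon>) (g \<epsilon>)) \<longlongrightarrow> 0) F"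
  shows "limitin (mtop X) f q F \<longleftrightarrow> limitin (mtop X) g q F"
proof (cases "q \<in> carrier X")
  case True
  have X: "X \<subseteq> charts X" using man by (rule smooth_manifold_charts)
  obtain V \<phi> where c: "(V, \<phi>) \<in> X" and q: "q \<in> V" using True by (rule carrier_in_atlas)
  obtain R where R: "R > 0" "cball (\<phi> q) R \<subseteq> \<phi> ` V" by (rule coordinate_ball[OF X c q])
  have near: "\<forall>\<^sub>F \<epsilon> in F. (f \<epsilon> \<in> V \<and> dist (\<phi> (f \<epsilon>)) (\<phi> q) < r \<or> g \<epsilon> \<in> V \<and> dist (\<phi> (g \<epsilon>)) (\<phi> q) < r) \<longrightarrow>
      f \<epsilon> \<in> V \<and> g \<epsilon> \<in> V \<and> dist (\<phi> (f \<epsilon>)) (\<phi> q) < 2 * r \<and> dist (\<phi> (g \<epsilon>)) (\<phi> q) < 2 * r"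
    if r: "r > 0" "2 * r \<le> R" for r
  proof -
    have "cball (\<phi> q) (2 * r) \<subseteq> \<phi> ` V" using R r by (meson order_trans subset_cball)
    then obtain m where m: "m > 0"
      "\<And>x y. x \<in> V \<and> dist (\<phi> x) (\<phi> q) < r \<or> y \<in> V \<and> dist (\<phi> y) (\<phi> q) < r \<Longrightarrow>
        riem_dist X h x y < ennreal (m * r) \<Longrightarrow>
        x \<in> V \<and> y \<in> V \<and> dist (\<phi> x) (\<phi> q) < 2 * r \<and> dist (\<phi> y) (\<phi> q) < 2 * r \<and>
        ennreal (m * dist (\<phi> x) (\<phi> y)) \<le> riem_dist X h x y"
      by (rule riem_dist_coordinates[OF man h c r(1)]) (rule that)
    have "\<forall>\<^sub>F \<epsilon> in F. riem_dist X h (f \<epsilon>) (g \<epsilon>) < ennreal (m * r)"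
      by (rule order_tendstoD(2)[OF d]) (use m r in simp)
    then show ?thesis by eventually_elim (use m(2) in blast)
  qed
  have transfer: "\<forall>\<^sub>F \<epsilon> in F. f \<epsilon> \<in> V \<and> g \<epsilon> \<in> V \<and> dist (\<phi> (f \<epsilon>)) (\<phi> q) < s \<and> dist (\<phi> (g \<epsilon>)) (\<phi> q) < s"
    if s: "s > 0" and lim: "limitin (mtop X) f q F \<or> limitin (mtop X) g q F" for s
  proof -
    \<comment> \<open>Passing from one net to the other doubles the radius: half of \<open>s\<close>
      compensates for this, half of \<open>R\<close> keeps the doubled ball inside the
      chart.\<close>
    define r where "r = min s R / 2"
    have r: "r > 0" "2 * r \<le> R" "2 * r \<le> s" using s R by (auto simp: r_def)
    have "(\<forall>\<^sub>F \<epsilon> in F. f \<epsilon> \<in> V \<and> dist (\<phi> (f \<epsilon>)) (\<phi> q) < r) \<or> (\<forall>\<^sub>F \<epsilon> in F. g \<epsilon> \<in> V \<and> dist (\<phi> (g \<epsilon>)) (\<phi> q) < r)"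
      using lim r(1) unfolding limitin_coordinates[OF X c q] by blast
    then have "\<forall>\<^sub>F \<epsilon> in F. f \<epsilon> \<in> V \<and> dist (\<phi> (f \<epsilon>)) (\<phi> q) < r \<or> g \<epsilon> \<in> V \<and> dist (\<phi> (g \<epsilon>)) (\<phi> q) < r"
      by (auto elim: eventually_mono)
    with near[OF r(1,2)] show ?thesis by eventually_elim (use r(3) in auto)
  qed
  then show ?thesis
    unfolding limitin_coordinates[OF X c q] by (smt (verit) eventually_mono)
next
  case False
  then show ?thesis using man by (auto simp: limitin_def topspace_mtop smooth_manifold_charts)
qed

text \<open>Uniformity on \<open>K\<close> is what allows the evaluation point to vary with
  \<epsilon>.\<close>

lemma riem_dist_sup_tendsto_0:
  assumes h: "((\<lambda>\<epsilon>. SUP p\<in>K. riem_dist Y h (u \<epsilon> p) (v \<epsilon> p)) \<longlongrightarrow> 0) F"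
    and x: "\<forall>\<^sub>F \<epsilon> in F. x \<epsilon> \<in> K"
  shows "((\<lambda>\<epsilon>. riem_dist Y h (u \<epsilon> (x \<epsilon>)) (v \<epsilon> (x \<epsilon>))) \<longlongrightarrow> 0) F"
proof (rule tendsto_sandwich[OF _ _ tendsto_const h])
  show "\<forall>\<^sub>F \<epsilon> in F. riem_dist Y h (u \<epsilon> (x \<epsilon>)) (v \<epsilon> (x \<epsilon>)) \<le> (SUP p\<in>K. riem_dist Y h (u \<epsilon> p) (v \<epsilon> p))"
    using x by eventually_elim (rule SUP_upper)
qed simp

lemma unif_close_limitin:
  fixes Y :: "('a, 'e::{real_inner,heine_borel}) atlas"
  assumes "smooth_manifold Y" "unif_close M Y u v" "compactin (mtop M) K"
    "\<forall>\<^sub>F \<epsilon> in at_right 0. x \<epsilon> \<in> K"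
  shows "limitin (mtop Y) (\<lambda>\<epsilon>. u \<epsilon> (x \<epsilon>)) q (at_right 0) \<longleftrightarrow>
         limitin (mtop Y) (\<lambda>\<epsilon>. v \<epsilon> (x \<epsilon>)) q (at_right 0)"
proof -
  obtain h where h: "riemannian_metric Y h"
    "((\<lambda>\<epsilon>. SUP p\<in>K. riem_dist Y h (u \<epsilon> p) (v \<epsilon> p)) \<longlongrightarrow> 0) (at_right 0)"
    using assms unfolding unif_close_def by blast
  show ?thesis
    by (rule riem_dist_limitin[OF assms(1) h(1) riem_dist_sup_tendsto_0[OF h(2) assms(4)]])
qed

lemma map_eqv_unif_close: "(u, v) \<in> map_eqv M Y \<Longrightarrow> unif_close M Y u v"
  by (simp add: map_eqv_def)

text \<open>A class in the quotient is the set of all partners of one net. Using that net as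
  intermediary replaces a proof that \<open>map_eqv\<close> is symmetric and transitive.\<close>

lemma gen_maps_representatives:
  assumes "\<Phi> \<in> gen_maps M Y" "u \<in> \<Phi>" "v \<in> \<Phi>"
  obtains w where "(w, u) \<in> map_eqv M Y" "(w, v) \<in> map_eqv M Y"
  using assms unfolding gen_maps_def quotient_def by blast

lemma gen_maps_limitin:
  fixes Y :: "('a, 'e::{real_inner,heine_borel}) atlas"
  assumes Y: "smooth_manifold Y" and \<Phi>: "\<Phi> \<in> gen_maps M Y" "u \<in> \<Phi>" "v \<in> \<Phi>"
    and K: "compactin (mtop M) K" "\<forall>\<^sub>F \<epsilon> in at_right 0. x \<epsilon> \<in> K"
  shows "limitin (mtop Y) (\<lambda>\<epsilon>. u \<epsilon> (x \<epsilon>)) q (at_right 0) \<longleftrightarrow>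
         limitin (mtop Y) (\<lambda>\<epsilon>. v \<epsilon> (x \<epsilon>)) q (at_right 0)"
proof -
  obtain w where w: "(w, u) \<in> map_eqv M Y" "(w, v) \<in> map_eqv M Y"
    by (rule gen_maps_representatives[OF \<Phi>])
  show ?thesis
    using unif_close_limitin[OF Y map_eqv_unif_close[OF w(1)] K]
      unif_close_limitin[OF Y map_eqv_unif_close[OF w(2)] K] by simp
qed

text \<open>Closeness is uniform only on compact sets; a convergent net of evaluation points is
  eventually inside a compact coordinate ball, which makes such estimates applicable to it.\<close>

lemma limitin_eventually_compact:
  fixes X :: "('a, 'e::{real_inner,heine_borel}) atlas"
  assumes X: "X \<subseteq> charts X" and lim: "limitin (mtop X) x q F"
  obtains K where "compactin (mtop X) K" "\<forall>\<^sub>F \<epsilon> in F. x \<epsilon> \<in> K"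
proof -
  have "q \<in> carrier X" using lim by (simp add: limitin_def topspace_mtop[OF X])
  then obtain V \<phi> where c: "(V, \<phi>) \<in> X" and q: "q \<in> V" by (rule carrier_in_atlas)
  obtain R where R: "R > 0" "cball (\<phi> q) R \<subseteq> \<phi> ` V" by (rule coordinate_ball[OF X c q])
  have "\<forall>\<^sub>F \<epsilon> in F. x \<epsilon> \<in> V \<and> dist (\<phi> (x \<epsilon>)) (\<phi> q) < R"
    using lim R(1) unfolding limitin_coordinates[OF X c q] by blast
  then have "\<forall>\<^sub>F \<epsilon> in F. x \<epsilon> \<in> V \<inter> \<phi> -` cball (\<phi> q) R"
    by eventually_elim (auto simp: dist_commute)
  then show ?thesis using that compactin_coordinate_ball[OF X c R(2)] by blast
qed

section \<open>Products with Euclidean space\<close>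

text \<open>The linear factor has one global chart and an arbitrary type, so the same development
  serves the time axis and the plane of time pairs.\<close>

lemma prod_open_atlas:
  "prod_atlas (open_atlas UNIV) X = (\<lambda>(V, \<phi>). (UNIV \<times> V, map_prod (\<lambda>x. x) \<phi>)) ` X"
  by (auto simp: prod_atlas_def open_atlas_def image_iff)

lemma carrier_prod_open_atlas: "carrier (prod_atlas (open_atlas UNIV) X) = UNIV \<times> carrier X"
  by (auto simp: carrier_def prod_open_atlas)

lemma openin_prod_open_atlas:
  assumes X: "X \<subseteq> charts X"
  shows "openin (mtop (prod_atlas (open_atlas UNIV) X)) U \<longleftrightarrow>
    U \<subseteq> UNIV \<times> carrier X \<and> (\<forall>(V, \<phi>)\<in>X. open (map_prod (\<lambda>x. x) \<phi> ` (U \<inter> UNIV \<times> V)))"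
proof -
  have "inj_on \<psi> W" if W: "(W, \<psi>) \<in> prod_atlas (open_atlas UNIV) X" for W \<psi>
  proof -
    obtain V \<phi> where "(V, \<phi>) \<in> X" "W = UNIV \<times> V" "\<psi> = map_prod (\<lambda>x. x) \<phi>"
      using W by (auto simp: prod_open_atlas)
    moreover from this have "inj_on \<phi> V" using X charts_inj_on by blast
    ultimately show ?thesis by (auto simp: inj_on_def)
  qed
  from openin_mtop_inj[OF this, of "prod_atlas (open_atlas UNIV) X" U] show ?thesis
    unfolding carrier_prod_open_atlas by (simp add: prod_open_atlas case_prod_unfold)
qed

lemma topspace_prod_open_atlas:
  assumes X: "X \<subseteq> charts X"
  shows "topspace (mtop (prod_atlas (open_atlas UNIV) X)) = UNIV \<times> carrier X"
proof
  show "topspace (mtop (prod_atlas (open_atlas UNIV) X)) \<subseteq> UNIV \<times> carrier X"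
    using openin_topspace openin_prod_open_atlas[OF X] by blast
  have "open (map_prod (\<lambda>x. x) \<phi> ` ((UNIV \<times> carrier X) \<inter> UNIV \<times> V))" if "(V, \<phi>) \<in> X" for V \<phi>
  proof -
    have "map_prod (\<lambda>x. x) \<phi> ` ((UNIV \<times> carrier X) \<inter> UNIV \<times> V) = UNIV \<times> \<phi> ` V"
      using that by (force simp: carrier_def)
    moreover have "open (\<phi> ` V)" using that X charts_open_image by blast
    ultimately show ?thesis using open_Times[OF open_UNIV] by metis
  qed
  then have "openin (mtop (prod_atlas (open_atlas UNIV) X)) (UNIV \<times> carrier X)"
    by (auto simp: openin_prod_open_atlas[OF X])
  then show "UNIV \<times> carrier X \<subseteq> topspace (mtop (prod_atlas (open_atlas UNIV) X))"
    by (rule openin_subset)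
qed

text \<open>Freezing the time turns compact subsets of \<open>X\<close> into compact subsets of the
  product, on which the estimates for the flow class are available.\<close>

lemma continuous_map_slice:
  fixes s :: "'s::real_normed_vector"
  assumes X: "X \<subseteq> charts X"
  shows "continuous_map (mtop X) (mtop (prod_atlas (open_atlas UNIV) X)) (\<lambda>x. (s, x))"
  unfolding continuous_map_def
proof (intro conjI allI impI)
  show "(\<lambda>x. (s, x)) \<in> topspace (mtop X) \<rightarrow> topspace (mtop (prod_atlas (open_atlas UNIV) X))"
    by (auto simp: topspace_mtop[OF X] topspace_prod_open_atlas[OF X])
  fix U :: "('s \<times> 'a) set" assume U: "openin (mtop (prod_atlas (open_atlas UNIV) X)) U"
  show "openin (mtop X) {x \<in> topspace (mtop X). (s, x) \<in> U}"
    unfolding openin_mtop[OF X] topspace_mtop[OF X]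
  proof (intro conjI ballI; clarify?)
    fix V \<phi> assume c: "(V, \<phi>) \<in> X"
    have "{x \<in> carrier X. (s, x) \<in> U} \<inter> V = {x \<in> V. (s, x) \<in> U}"
      using c by (auto simp: carrier_def)
    moreover have "\<phi> ` {x \<in> V. (s, x) \<in> U} = Pair s -` (map_prod (\<lambda>x. x) \<phi> ` (U \<inter> UNIV \<times> V))"
      by force
    moreover have "open (Pair s -` (map_prod (\<lambda>x. x) \<phi> ` (U \<inter> UNIV \<times> V)))"
      using U c unfolding openin_prod_open_atlas[OF X]
      by (intro open_vimage) (auto intro!: continuous_intros)
    ultimately show "open (\<phi> ` ({x \<in> carrier X. (s, x) \<in> U} \<inter> V))" by simp
  qed
qed

text \<open>Equivalence of nets on the product is tested in charts of the maximal product atlas;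
  this provides the one around \<open>(t, p)\<close>. Coordinate changes are the identity in the
  linear factor.\<close>

lemma prod_open_atlas_chart:
  fixes X :: "('a, 'e::{real_inner,heine_borel}) atlas"
  assumes X: "X \<subseteq> charts X" and c: "(V, \<phi>) \<in> X"
  shows "((UNIV :: 's::real_normed_vector set) \<times> V, map_prod (\<lambda>x. x) \<phi>) \<in> charts (prod_atlas (open_atlas UNIV) X)"
proof -
  have inj: "inj_on \<phi> V" and op: "open (\<phi> ` V)"
    using assms charts_inj_on charts_open_image by blast+
  have img: "map_prod (\<lambda>x. x) \<phi> ` (UNIV \<times> A) = (UNIV :: 's set) \<times> \<phi> ` A" for \<phi> :: "'a \<Rightarrow> 'e" and A
    by force
  have inv: "inv_into ((UNIV :: 's set) \<times> V) (map_prod (\<lambda>x. x) \<phi>) (s, y) = (s, inv_into V \<phi> y)"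
    if c: "(V, \<phi>) \<in> X" and y: "y \<in> \<phi> ` V" for V \<phi> s y
  proof (rule inv_into_f_eq)
    have "inj_on \<phi> V" using X c charts_inj_on by blast
    then show "inj_on (map_prod (\<lambda>x. x) \<phi>) (UNIV \<times> V)" by (auto simp: inj_on_def)
  qed (use y in \<open>auto simp: inv_into_into f_inv_into_f\<close>)
  have half: "smooth_on ((UNIV :: 's set) \<times> \<phi> ` (V \<inter> W)) (map_prod (\<lambda>x. x) \<psi> \<circ> inv_into (UNIV \<times> V) (map_prod (\<lambda>x. x) \<phi>))"
    if V: "(V, \<phi>) \<in> X" and W: "(W, \<psi>) \<in> X" for V \<phi> W \<psi>
  proof -
    have "compatible (V, \<phi>) (W, \<psi>)" using X V W by (auto simp: charts_def)
    then have s: "open (\<phi> ` (V \<inter> W))" "smooth_on (\<phi> ` (V \<inter> W)) (\<psi> \<circ> inv_into V \<phi>)"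
      unfolding compatible_def by simp_all
    show ?thesis
    proof (rule smooth_on_cong_open)
      show "open ((UNIV :: 's set) \<times> \<phi> ` (V \<inter> W))" using s by (simp add: open_Times)
      show "smooth_on ((UNIV :: 's set) \<times> \<phi> ` (V \<inter> W)) (map_prod (\<lambda>x. x) (\<psi> \<circ> inv_into V \<phi>))"
        using s by (intro smooth_on_map_prod smooth_on_id) auto
      fix z assume "z \<in> (UNIV :: 's set) \<times> \<phi> ` (V \<inter> W)"
      then obtain t y where z: "z = (t, y)" "y \<in> \<phi> ` V" by auto
      show "map_prod (\<lambda>x. x) (\<psi> \<circ> inv_into V \<phi>) z =
          (map_prod (\<lambda>x. x) \<psi> \<circ> inv_into (UNIV \<times> V) (map_prod (\<lambda>x. x) \<phi>)) z"
        using inv[OF V z(2)] by (simp add: z(1))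
    qed
  qed
  have "compatible ((UNIV :: 's set) \<times> V, map_prod (\<lambda>x. x) \<phi>) (UNIV \<times> W, map_prod (\<lambda>x. x) \<psi>)"
    if W: "(W, \<psi>) \<in> X" for W \<psi>
  proof -
    have "compatible (V, \<phi>) (W, \<psi>)" using X c W by (auto simp: charts_def)
    then have "open (\<phi> ` (V \<inter> W))" "open (\<psi> ` (V \<inter> W))" by (simp_all add: compatible_def)
    moreover have "(UNIV :: 's set) \<times> V \<inter> UNIV \<times> W = UNIV \<times> (V \<inter> W)" by auto
    ultimately show ?thesis
      using half[OF c W] half[OF W c] by (simp add: compatible_def img open_Times Int_commute)
  qed
  moreover have "inj_on (map_prod (\<lambda>x. x) \<phi>) ((UNIV :: 's set) \<times> V)" using inj by (auto simp: inj_on_def)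
  moreover have "(UNIV :: 's set) \<times> V \<subseteq> carrier (prod_atlas (open_atlas UNIV) X)"
    using c unfolding carrier_prod_open_atlas by (auto simp: carrier_def)
  ultimately show ?thesis
    using op by (auto simp: charts_def prod_open_atlas img open_Times)
qed

section \<open>Rapid convergence in coordinates\<close>

text \<open>Fast convergence in one chart, free of any metric. It carries no condition that
  \<open>x\<close> stays in the domain of \<open>\<phi>\<close>, so it is used together with a
  \<open>limitin\<close> statement.\<close>

definition rapidly_near :: "('a \<Rightarrow> 'e::real_normed_vector) \<Rightarrow> (real \<Rightarrow> 'a) \<Rightarrow> 'a \<Rightarrow> bool" where
  "rapidly_near \<phi> x q \<longleftrightarrow>
     (\<forall>m::nat. \<exists>C. \<forall>\<^sub>F \<epsilon> in at_right 0. dist (\<phi> (x \<epsilon>)) (\<phi> q) \<le> C * \<epsilon> powr real m)"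

lemma rapidly_near_cong:
  assumes x: "rapidly_near \<phi> x q"
    and d: "\<And>m::nat. \<exists>C. \<forall>\<^sub>F \<epsilon> in at_right 0. dist (\<phi> (x \<epsilon>)) (\<phi> (y \<epsilon>)) \<le> C * \<epsilon> powr real m"
  shows "rapidly_near \<phi> y q"
  unfolding rapidly_near_def
proof
  fix m :: nat
  obtain C D where "\<forall>\<^sub>F \<epsilon> in at_right 0. dist (\<phi> (x \<epsilon>)) (\<phi> q) \<le> C * \<epsilon> powr real m"
    "\<forall>\<^sub>F \<epsilon> in at_right 0. dist (\<phi> (x \<epsilon>)) (\<phi> (y \<epsilon>)) \<le> D * \<epsilon> powr real m"
    using x d[of m] unfolding rapidly_near_def by blast
  then have "\<forall>\<^sub>F \<epsilon> in at_right 0. dist (\<phi> (y \<epsilon>)) (\<phi> q) \<le> (C + D) * \<epsilon> powr real m"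
  proof eventually_elim
    case (elim \<epsilon>)
    then show ?case
      using dist_triangle[of "\<phi> (y \<epsilon>)" "\<phi> q" "\<phi> (x \<epsilon>)"] by (simp add: distrib_right dist_commute)
  qed
  then show "\<exists>C. \<forall>\<^sub>F \<epsilon> in at_right 0. dist (\<phi> (y \<epsilon>)) (\<phi> q) \<le> C * \<epsilon> powr real m" by blast
qed

lemma powr_at_right_0_tendsto: "((\<lambda>\<epsilon>. C * \<epsilon> powr 1) \<longlongrightarrow> 0) (at_right (0::real))"
proof -
  have "((\<lambda>\<epsilon>. C * \<epsilon>) \<longlongrightarrow> C * 0) (at_right (0::real))" by (intro tendsto_intros)
  moreover have "\<forall>\<^sub>F \<epsilon> in at_right (0::real). C * \<epsilon> = C * \<epsilon> powr 1"
    by (auto simp: eventually_at_filter)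
  ultimately have "((\<lambda>\<epsilon>. C * \<epsilon> powr 1) \<longlongrightarrow> C * 0) (at_right (0::real))"
    by (rule Lim_transform_eventually)
  then show ?thesis by simp
qed

text \<open>Order one alone forces the distance to 0 and hence convergence. The points are then
  close enough for \<open>riem_dist_coordinates\<close>, which passes every order on to coordinates
  at the cost of a factor \<open>1 / \<mu>\<close>.\<close>

lemma rapid_riem_dist:
  fixes X :: "('a, 'e::{real_inner,heine_borel}) atlas"
  assumes man: "smooth_manifold X" and h: "riemannian_metric X h" and q: "q \<in> carrier X"
    and d: "\<And>m::nat. \<exists>C. \<forall>\<^sub>F \<epsilon> in at_right 0. riem_dist X h (x \<epsilon>) q \<le> ennreal (C * \<epsilon> powr real m)"
  shows "limitin (mtop X) x q (at_right 0)"
    "(V, \<phi>) \<in> X \<Longrightarrow> q \<in> V \<Longrightarrow> rapidly_near \<phi> x q"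
proof -
  have X: "X \<subseteq> charts X" using man by (rule smooth_manifold_charts)
  have "((\<lambda>\<epsilon>. riem_dist X h (x \<epsilon>) q) \<longlongrightarrow> 0) (at_right 0)"
  proof -
    obtain C where C: "\<forall>\<^sub>F \<epsilon> in at_right 0. riem_dist X h (x \<epsilon>) q \<le> ennreal (C * \<epsilon> powr real 1)"
      using d by blast
    have "((\<lambda>\<epsilon>. ennreal (C * \<epsilon> powr real 1)) \<longlongrightarrow> ennreal 0) (at_right 0)"
      using powr_at_right_0_tendsto by (intro tendsto_ennrealI) simp
    then show ?thesis by (intro tendsto_sandwich[OF _ C tendsto_const]) simp_all
  qed
  note lim0 = this
  have "limitin (mtop X) (\<lambda>_. q) q (at_right 0)" using q by (simp add: topspace_mtop[OF X])
  then show lim: "limitin (mtop X) x q (at_right 0)"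
    using riem_dist_limitin[OF man h lim0] by simp
  assume c: "(V, \<phi>) \<in> X" and qV: "q \<in> V"
  obtain R where R: "R > 0" "cball (\<phi> q) R \<subseteq> \<phi> ` V" by (rule coordinate_ball[OF X c qV])
  have "R / 2 > 0" "cball (\<phi> q) (2 * (R / 2)) \<subseteq> \<phi> ` V" using R by simp_all
  then obtain \<mu> where \<mu>: "\<mu> > 0"
    "\<And>x y. x \<in> V \<and> dist (\<phi> x) (\<phi> q) < R / 2 \<or> y \<in> V \<and> dist (\<phi> y) (\<phi> q) < R / 2 \<Longrightarrow>
      riem_dist X h x y < ennreal (\<mu> * (R / 2)) \<Longrightarrow>
      x \<in> V \<and> y \<in> V \<and> dist (\<phi> x) (\<phi> q) < 2 * (R / 2) \<and> dist (\<phi> y) (\<phi> q) < 2 * (R / 2) \<and>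
      ennreal (\<mu> * dist (\<phi> x) (\<phi> y)) \<le> riem_dist X h x y"
    by (rule riem_dist_coordinates[OF man h c]) (rule that)
  have near: "\<forall>\<^sub>F \<epsilon> in at_right 0. riem_dist X h (x \<epsilon>) q < ennreal (\<mu> * (R / 2))"
    by (rule order_tendstoD(2)[OF lim0]) (use \<mu> R in simp)
  show "rapidly_near \<phi> x q"
    unfolding rapidly_near_def
  proof
    fix m :: nat
    obtain C where C: "\<forall>\<^sub>F \<epsilon> in at_right 0. riem_dist X h (x \<epsilon>) q \<le> ennreal (C * \<epsilon> powr real m)"
      using d by blast
    with near have "\<forall>\<^sub>F \<epsilon> in at_right 0. dist (\<phi> (x \<epsilon>)) (\<phi> q) \<le> (\<bar>C\<bar> / \<mu>) * \<epsilon> powr real m"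
    proof eventually_elim
      case (elim \<epsilon>)
      have "ennreal (\<mu> * dist (\<phi> (x \<epsilon>)) (\<phi> q)) \<le> riem_dist X h (x \<epsilon>) q"
        using \<mu>(2)[of "x \<epsilon>" q] elim(1) qV R by simp
      also have "\<dots> \<le> ennreal (C * \<epsilon> powr real m)" by (rule elim(2))
      \<comment> \<open>The constant may be negative, in which case \<open>ennreal\<close> truncates
        to 0; the absolute value allows the coercion to be removed.\<close>
      also have "\<dots> \<le> ennreal (\<bar>C\<bar> * \<epsilon> powr real m)"
        by (intro ennreal_leI mult_right_mono) auto
      finally have "\<mu> * dist (\<phi> (x \<epsilon>)) (\<phi> q) \<le> \<bar>C\<bar> * \<epsilon> powr real m"
        by (simp add: ennreal_le_iff)
      then show ?case using \<mu>(1) by (simp add: field_simps)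
    qed
    then show "\<exists>C. \<forall>\<^sub>F \<epsilon> in at_right 0. dist (\<phi> (x \<epsilon>)) (\<phi> q) \<le> C * \<epsilon> powr real m" by blast
  qed
qed

text \<open>The order-zero clause of \<open>map_eqv\<close>, taken at the single point
  \<open>p\<close>, bounds the coordinate difference by every power of \<epsilon>. It applies when
  both values lie in a compact part of the chart, which the two limits ensure.\<close>

lemma map_eqv_rapid:
  fixes X :: "('a, 'e::{real_inner,heine_borel}) atlas"
  assumes X: "X \<subseteq> charts X" and uv: "(u, v) \<in> map_eqv M X"
    and Z: "(Z, \<zeta>) \<in> charts M" "p \<in> Z" "p \<in> topspace (mtop M)"
    and c: "(V, \<phi>) \<in> X" and q: "q \<in> V"
    and lim: "limitin (mtop X) (\<lambda>\<epsilon>. u \<epsilon> p) q (at_right 0)" "limitin (mtop X) (\<lambda>\<epsilon>. v \<epsilon> p) q (at_right 0)"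
  shows "rapidly_near \<phi> (\<lambda>\<epsilon>. u \<epsilon> p) q \<longleftrightarrow> rapidly_near \<phi> (\<lambda>\<epsilon>. v \<epsilon> p) q"
proof -
  obtain R where R: "R > 0" "cball (\<phi> q) R \<subseteq> \<phi> ` V" by (rule coordinate_ball[OF X c q])
  define L where "L = V \<inter> \<phi> -` cball (\<phi> q) R"
  have L: "compactin (mtop X) L" "L \<subseteq> V"
    unfolding L_def using compactin_coordinate_ball[OF X c R(2)] by auto
  have p: "compactin (mtop M) {p}" using Z by (simp add: compactin_sing)
  have inv: "inv_into Z \<zeta> (\<zeta> p) = p" using inv_into_f_f[OF charts_inj_on[OF Z(1)] Z(2)] .
  have "\<forall>\<^sub>F \<epsilon> in at_right 0. u \<epsilon> p \<in> V \<and> dist (\<phi> (u \<epsilon> p)) (\<phi> q) < R"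
    "\<forall>\<^sub>F \<epsilon> in at_right 0. v \<epsilon> p \<in> V \<and> dist (\<phi> (v \<epsilon> p)) (\<phi> q) < R"
    using lim R(1) unfolding limitin_coordinates[OF X c q] by blast+
  then have inL: "\<forall>\<^sub>F \<epsilon> in at_right 0. p \<in> {p} \<inter> u \<epsilon> -` L \<inter> v \<epsilon> -` L"
    by eventually_elim (auto simp: L_def dist_commute)
  have d: "\<exists>C. \<forall>\<^sub>F \<epsilon> in at_right 0. dist (\<phi> (u \<epsilon> p)) (\<phi> (v \<epsilon> p)) \<le> C * \<epsilon> powr real m" for m :: nat
  proof -
    have "unif_bigO (\<lambda>\<epsilon>. {p} \<inter> u \<epsilon> -` L \<inter> v \<epsilon> -` L)
          (\<lambda>\<epsilon> p. deriv_norm 0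
             (\<lambda>x. (\<phi> \<circ> u \<epsilon> \<circ> inv_into Z \<zeta>) x - (\<phi> \<circ> v \<epsilon> \<circ> inv_into Z \<zeta>) x) (\<zeta> p)) (real m)"
      using uv Z c X L p unfolding map_eqv_def by blast
    then obtain C where "\<forall>\<^sub>F \<epsilon> in at_right 0. \<forall>p\<in>{p} \<inter> u \<epsilon> -` L \<inter> v \<epsilon> -` L. deriv_norm 0
             (\<lambda>x. (\<phi> \<circ> u \<epsilon> \<circ> inv_into Z \<zeta>) x - (\<phi> \<circ> v \<epsilon> \<circ> inv_into Z \<zeta>) x) (\<zeta> p) \<le> ennreal (C * \<epsilon> powr real m)"
      unfolding unif_bigO_def by blast
    with inL have "\<forall>\<^sub>F \<epsilon> in at_right 0. dist (\<phi> (u \<epsilon> p)) (\<phi> (v \<epsilon> p)) \<le> \<bar>C\<bar> * \<epsilon> powr real m"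
    proof eventually_elim
      case (elim \<epsilon>)
      then have "ennreal (dist (\<phi> (u \<epsilon> p)) (\<phi> (v \<epsilon> p))) \<le> ennreal (C * \<epsilon> powr real m)"
        using inv by (auto simp: deriv_norm_0 dist_norm)
      also have "\<dots> \<le> ennreal (\<bar>C\<bar> * \<epsilon> powr real m)"
        by (intro ennreal_leI mult_right_mono) auto
      finally show ?case by (simp add: ennreal_le_iff)
    qed
    then show ?thesis by blast
  qed
  show ?thesis
    using rapidly_near_cong[where \<phi>=\<phi> and x="\<lambda>\<epsilon>. u \<epsilon> p" and y="\<lambda>\<epsilon>. v \<epsilon> p"] d
      rapidly_near_cong[where \<phi>=\<phi> and x="\<lambda>\<epsilon>. v \<epsilon> p" and y="\<lambda>\<epsilon>. u \<epsilon> p"] d[unfolded dist_commute[of "\<phi> (u _ p)"]]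
    by blast
qed

text \<open>A moderate net expands distances by at most a negative power of \<open>\<epsilon>\<close>, as long as its values
  stay in a fixed coordinate ball; rapid convergence of the arguments compensates for this and
  thereby also keeps the values in the ball.\<close>

lemma mod_maps_rapid_limitin:
  fixes X :: "('a, 'e::{real_inner,heine_borel}) atlas" and Y :: "('b, 'f::{real_inner,heine_borel}) atlas"
  assumes X: "X \<subseteq> charts X" and Y: "smooth_manifold Y" and w: "w \<in> mod_maps X Y"
    and c: "(V, \<phi>) \<in> X" and q: "q \<in> V"
    and x: "limitin (mtop X) x q (at_right 0)" and rapid: "rapidly_near \<phi> x q"
    and lim: "limitin (mtop Y) (\<lambda>\<epsilon>. w \<epsilon> q) y (at_right 0)"
  shows "limitin (mtop Y) (\<lambda>\<epsilon>. w \<epsilon> (x \<epsilon>)) y (at_right 0)"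
proof -
  have cY: "Y \<subseteq> charts Y" using Y by (rule smooth_manifold_charts)
  have cm: "(V, \<phi>) \<in> charts X" using X c by blast
  have inj: "inj_on \<phi> V" using cm charts_inj_on by blast
  have "y \<in> carrier Y" using lim by (simp add: limitin_def topspace_mtop[OF cY])
  then obtain W \<psi> where W: "(W, \<psi>) \<in> Y" and yW: "y \<in> W" by (rule carrier_in_atlas)
  have Wm: "(W, \<psi>) \<in> charts Y" using W cY by blast
  obtain R where R: "R > 0" "cball (\<phi> q) R \<subseteq> \<phi> ` V" by (rule coordinate_ball[OF X c q])
  define L where "L = V \<inter> \<phi> -` cball (\<phi> q) R"
  have L: "compactin (mtop X) L" "L \<subseteq> V"
    unfolding L_def using compactin_coordinate_ball[OF X c R(2)] by auto
  obtain R' where R': "R' > 0" "cball (\<psi> y) R' \<subseteq> \<psi> ` W" by (rule coordinate_ball[OF cY W yW])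
  have "\<forall>\<^sub>F \<epsilon> in at_right 0. w \<epsilon> (x \<epsilon>) \<in> W \<and> dist (\<psi> (w \<epsilon> (x \<epsilon>))) (\<psi> y) < s" if s: "s > 0" for s
  proof -
    define r where "r = min s R' / 2"
    have r: "r > 0" "2 * r \<le> R'" "2 * r \<le> s" using s R' by (auto simp: r_def)
    have b: "cball (\<psi> y) (2 * r) \<subseteq> \<psi> ` W" using R' r by (meson order_trans subset_cball)
    define L' where "L' = W \<inter> \<psi> -` cball (\<psi> y) (2 * r)"
    have L': "compactin (mtop Y) L'" "L' \<subseteq> W"
      unfolding L'_def using compactin_coordinate_ball[OF cY W b] by auto
    have "\<exists>N::nat. unif_bigO (\<lambda>\<epsilon>. L \<inter> w \<epsilon> -` L')
           (\<lambda>\<epsilon> p. deriv_norm 1 (\<psi> \<circ> w \<epsilon> \<circ> inv_into V \<phi>) (\<phi> p)) (- real N)"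
      using w cm Wm L L' unfolding mod_maps_def by blast
    then obtain N :: nat and C where C: "\<forall>\<^sub>F \<epsilon> in at_right 0. \<forall>p\<in>L \<inter> w \<epsilon> -` L'.
        deriv_norm 1 (\<psi> \<circ> w \<epsilon> \<circ> inv_into V \<phi>) (\<phi> p) \<le> ennreal (C * \<epsilon> powr (- real N))"
      unfolding unif_bigO_def by blast
    \<comment> \<open>One order more than the growth \<open>N\<close> of the derivative leaves a
      factor \<epsilon>, which makes the product of both bounds eventually smaller than
      \<open>r\<close>.\<close>
    obtain D where D: "\<forall>\<^sub>F \<epsilon> in at_right 0. dist (\<phi> (x \<epsilon>)) (\<phi> q) \<le> D * \<epsilon> powr real (N + 1)"
      using rapid unfolding rapidly_near_def by blast
    have small: "\<forall>\<^sub>F \<epsilon> in at_right 0. \<bar>C\<bar> * D * \<epsilon> powr 1 < r"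
      using order_tendstoD(2)[OF powr_at_right_0_tendsto r(1)] .
    have unit: "\<forall>\<^sub>F \<epsilon> in at_right (0::real). \<epsilon> \<in> {0<..1}"
      using eventually_at_right_real[of 0 "1::real"] by (auto elim: eventually_mono)
    have start: "\<forall>\<^sub>F \<epsilon> in at_right 0. w \<epsilon> q \<in> W \<and> dist (\<psi> (w \<epsilon> q)) (\<psi> y) < r"
      using lim r(1) unfolding limitin_coordinates[OF cY W yW] by blast
    have xL: "\<forall>\<^sub>F \<epsilon> in at_right 0. x \<epsilon> \<in> V \<and> dist (\<phi> (x \<epsilon>)) (\<phi> q) < R"
      using x R(1) unfolding limitin_coordinates[OF X c q] by blast
    from C D small unit start xL show ?thesis
    proof eventually_elim
      case (elim \<epsilon>)
      define B where "B = \<bar>C\<bar> * \<epsilon> powr (- real N)"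
      have B: "B \<ge> 0" by (simp add: B_def)
      define d where "d = \<phi> (x \<epsilon>) - \<phi> q"
      \<comment> \<open>The coordinate segment from \<open>\<phi> q\<close> to
        \<open>\<phi> (x \<epsilon>)\<close> is mapped to a curve in \<open>Y\<close> joining
        \<open>w \<epsilon> q\<close> to \<open>w \<epsilon> (x \<epsilon>)\<close>, to which the
        first-exit argument applies.\<close>
      define l where "l = (\<lambda>\<tau>::real. \<phi> q + \<tau> *\<^sub>R d)"
      define g where "g = \<psi> \<circ> w \<epsilon> \<circ> inv_into V \<phi>"
      define \<gamma> where "\<gamma> = w \<epsilon> \<circ> inv_into V \<phi> \<circ> l"
      have sm: "smooth_map X Y (w \<epsilon>)" using w elim by (simp add: mod_maps_def)
      have lball: "l \<tau> \<in> cball (\<phi> q) R" if "\<tau> \<in> {0..1}" for \<tau>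
      proof -
        have "\<tau> * norm d \<le> 1 * norm d" using that by (intro mult_right_mono) auto
        then show ?thesis using that elim by (simp add: l_def d_def dist_norm)
      qed
      then have lV: "l \<tau> \<in> \<phi> ` V" if "\<tau> \<in> {0..1}" for \<tau> using R(2) that by blast
      have Bd: "B * norm d < r"
      proof -
        have "B * norm d \<le> B * (D * \<epsilon> powr real (N + 1))"
          using elim(2) B by (intro mult_left_mono) (auto simp: d_def dist_norm)
        also have "\<dots> = \<bar>C\<bar> * D * (\<epsilon> powr (- real N) * \<epsilon> powr real (N + 1))" by (simp add: B_def)
        also have "\<epsilon> powr (- real N) * \<epsilon> powr real (N + 1) = \<epsilon> powr 1"
          unfolding powr_add[symmetric] by simp
        finally show ?thesis using elim(3) by linarith
      qed
      have "continuous_map (top_of_set {0..1}) (top_of_set (\<phi> ` V)) l"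
        using lV by (auto simp: continuous_map_in_subtopology l_def intro!: continuous_intros)
      then have "continuous_map (top_of_set {0..1}) (mtop X) (inv_into V \<phi> \<circ> l)"
        by (rule continuous_map_compose[OF _ continuous_map_chart_inv[OF X c]])
      then have cont: "continuous_map (top_of_set {0..1}) (mtop Y) \<gamma>"
        using sm continuous_map_compose unfolding \<gamma>_def smooth_map_def comp_assoc by blast
      have \<gamma>0: "\<gamma> 0 = w \<epsilon> q" and \<gamma>1: "\<gamma> 1 = w \<epsilon> (x \<epsilon>)"
        using q elim inj by (simp_all add: \<gamma>_def l_def d_def)
      have "\<gamma> ` {0..1} \<subseteq> W \<inter> \<psi> -` ball (\<psi> y) (2 * r)"
      proof (rule exit_coordinate_ball[OF Y W b cont])
        show "\<gamma> 0 \<in> W" "dist (\<psi> (\<gamma> 0)) (\<psi> y) < r" using elim \<gamma>0 by simp_all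
        \<comment> \<open>Up to \<open>T\<close> the values lie in \<open>L'\<close> by the
          provisional assumption, hence the derivative bound of the moderate net is valid along the
          segment and the mean value inequality applies.\<close>
        fix T assume T: "0 \<le> T" "T \<le> 1" and sub: "\<gamma> ` {0..T} \<subseteq> W \<inter> \<psi> -` cball (\<psi> y) (2 * r)"
        have "norm ((g \<circ> l) T - (g \<circ> l) 0) \<le> (B * norm d) * norm (T - 0)"
        proof (rule differentiable_bound[where S = "{0..T}" and f' = "\<lambda>\<tau> s. frechet_derivative g (at (l \<tau>)) (s *\<^sub>R d)"])
          fix \<tau> assume \<tau>: "\<tau> \<in> {0..T}"
          then have \<tau>1: "\<tau> \<in> {0..1}" using T by auto
          define p where "p = inv_into V \<phi> (l \<tau>)"
          have p: "p \<in> V" "\<phi> p = l \<tau>" using lV[OF \<tau>1] by (simp_all add: p_def inv_into_into f_inv_into_f)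
          have pL: "p \<in> L" using p lball[OF \<tau>1] by (simp add: L_def)
          have "\<gamma> \<tau> \<in> L'" using sub \<tau> unfolding L'_def by blast
          then have wp: "w \<epsilon> p \<in> L'" by (simp add: \<gamma>_def p_def)
          have "smooth_on (\<phi> ` (V \<inter> w \<epsilon> -` W)) g"
            using sm cm Wm unfolding smooth_map_def g_def by blast
          then have diff: "g differentiable (at (l \<tau>))"
            using p wp L' by (metis IntI imageI smooth_on_differentiable subsetD vimageI)
          have "deriv_norm 1 g (\<phi> p) \<le> ennreal (C * \<epsilon> powr (- real N))"
            using elim(1) pL wp unfolding g_def by blast
          also have "\<dots> \<le> ennreal B" unfolding B_def by (intro ennreal_leI mult_right_mono) auto
          finally have le: "deriv_norm 1 g (l \<tau>) \<le> ennreal B" by (simp add: p)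
          have "(l has_derivative (\<lambda>s. s *\<^sub>R d)) (at \<tau> within {0..T})"
            unfolding l_def by (auto intro!: derivative_eq_intros)
          moreover have "(g has_derivative frechet_derivative g (at (l \<tau>))) (at (l \<tau>))"
            using diff frechet_derivative_works by blast
          ultimately show "(g \<circ> l has_derivative (\<lambda>s. frechet_derivative g (at (l \<tau>)) (s *\<^sub>R d))) (at \<tau> within {0..T})"
            using has_derivative_compose[of l] by (simp add: comp_def)
          show "onorm (\<lambda>s. frechet_derivative g (at (l \<tau>)) (s *\<^sub>R d)) \<le> B * norm d"
          proof (rule onorm_le)
            fix s :: real
            show "norm (frechet_derivative g (at (l \<tau>)) (s *\<^sub>R d)) \<le> B * norm d * norm s"
              using deriv_norm_1_bound[OF le B diff, of "s *\<^sub>R d"] by (simp add: mult_ac)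
          qed
        qed (use T in auto)
        also have "\<dots> \<le> B * norm d * 1" using T B by (intro mult_left_mono) auto
        also have "\<dots> < r" using Bd by simp
        finally show "dist (\<psi> (\<gamma> T)) (\<psi> (\<gamma> 0)) < r" by (simp add: dist_norm \<gamma>_def g_def)
      qed
      moreover have "\<gamma> 1 \<in> \<gamma> ` {0..1}" by simp
      ultimately have "w \<epsilon> (x \<epsilon>) \<in> W \<inter> \<psi> -` ball (\<psi> y) (2 * r)" using \<gamma>1 by auto
      then show ?case using r(3) by (auto simp: dist_commute)
    qed
  qed
  then show ?thesis unfolding limitin_coordinates[OF cY W yW] by blast
qed

text \<open>The classical uniform limit argument, stated along a filter: \<open>f\<close> is
  compared with \<open>w e\<close> at one well-chosen index \<open>e\<close>, and continuity of
  \<open>w e\<close> handles the moving argument. The filter \<open>F\<close> is unrelated to the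
  index of \<open>w\<close>.\<close>

lemma unif_close_const_limitin:
  fixes X :: "('a, 'e::{real_inner,heine_borel}) atlas" and Y :: "('b, 'f::{real_inner,heine_borel}) atlas"
  assumes X: "X \<subseteq> charts X" and Y: "smooth_manifold Y"
    and w: "\<And>\<epsilon>. \<epsilon> \<in> {0<..1} \<Longrightarrow> continuous_map (mtop X) (mtop Y) (w \<epsilon>)"
    and close: "unif_close X Y w (\<lambda>_. f)" and fq: "f q \<in> carrier Y"
    and x: "limitin (mtop X) x q F"
  shows "limitin (mtop Y) (\<lambda>\<epsilon>. f (x \<epsilon>)) (f q) F"
proof -
  have cY: "Y \<subseteq> charts Y" using Y by (rule smooth_manifold_charts)
  have "q \<in> carrier X" using x by (simp add: limitin_def topspace_mtop[OF X])
  then obtain V \<phi> where c: "(V, \<phi>) \<in> X" and q: "q \<in> V" by (rule carrier_in_atlas)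
  obtain W \<psi> where W: "(W, \<psi>) \<in> Y" and yW: "f q \<in> W" using fq by (rule carrier_in_atlas)
  obtain R where R: "R > 0" "cball (\<phi> q) R \<subseteq> \<phi> ` V" by (rule coordinate_ball[OF X c q])
  define K where "K = V \<inter> \<phi> -` cball (\<phi> q) R"
  have K: "compactin (mtop X) K" unfolding K_def using compactin_coordinate_ball[OF X c R(2)] .
  have qK: "q \<in> K" using q R by (simp add: K_def)
  obtain R' where R': "R' > 0" "cball (\<psi> (f q)) R' \<subseteq> \<psi> ` W" by (rule coordinate_ball[OF cY W yW])
  obtain h where h: "riemannian_metric Y h"
    and d: "((\<lambda>\<epsilon>. SUP p\<in>K. riem_dist Y h (w \<epsilon> p) (f p)) \<longlongrightarrow> 0) (at_right 0)"
    using close K unfolding unif_close_def by blast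
  have "limitin (mtop Y) (\<lambda>_. f q) (f q) (at_right 0)" using fq by (simp add: topspace_mtop[OF cY])
  then have lim: "limitin (mtop Y) (\<lambda>\<epsilon>. w \<epsilon> q) (f q) (at_right 0)"
    using riem_dist_limitin[OF Y h riem_dist_sup_tendsto_0[OF d, of "\<lambda>_. q"]] qK by simp
  have "\<forall>\<^sub>F \<epsilon> in F. f (x \<epsilon>) \<in> W \<and> dist (\<psi> (f (x \<epsilon>))) (\<psi> (f q)) < s" if s: "s > 0" for s
  proof -
    define r where "r = min s R' / 2"
    have r: "r > 0" "2 * r \<le> R'" "2 * r \<le> s" using s R' by (auto simp: r_def)
    have b: "cball (\<psi> (f q)) (2 * r) \<subseteq> \<psi> ` W" using R' r by (meson order_trans subset_cball)
    obtain m where m: "m > 0"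
      "\<And>x y. x \<in> W \<and> dist (\<psi> x) (\<psi> (f q)) < r \<or> y \<in> W \<and> dist (\<psi> y) (\<psi> (f q)) < r \<Longrightarrow>
        riem_dist Y h x y < ennreal (m * r) \<Longrightarrow>
        x \<in> W \<and> y \<in> W \<and> dist (\<psi> x) (\<psi> (f q)) < 2 * r \<and> dist (\<psi> y) (\<psi> (f q)) < 2 * r \<and>
        ennreal (m * dist (\<psi> x) (\<psi> y)) \<le> riem_dist Y h x y"
      by (rule riem_dist_coordinates[OF Y h W r(1) b]) (rule that)
    have "\<forall>\<^sub>F \<epsilon> in at_right 0. (SUP p\<in>K. riem_dist Y h (w \<epsilon> p) (f p)) < ennreal (m * r)"
      by (rule order_tendstoD(2)[OF d]) (use m r in simp)
    moreover have "\<forall>\<^sub>F \<epsilon> in at_right 0. w \<epsilon> q \<in> W \<and> dist (\<psi> (w \<epsilon> q)) (\<psi> (f q)) < r"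
      using lim r(1) unfolding limitin_coordinates[OF cY W yW] by blast
    moreover have "\<forall>\<^sub>F \<epsilon> in at_right (0::real). \<epsilon> \<in> {0<..1}"
      using eventually_at_right_real[of 0 "1::real"] by (auto elim: eventually_mono)
    ultimately have "\<forall>\<^sub>F \<epsilon> in at_right 0. (SUP p\<in>K. riem_dist Y h (w \<epsilon> p) (f p)) < ennreal (m * r) \<and>
        w \<epsilon> q \<in> W \<and> dist (\<psi> (w \<epsilon> q)) (\<psi> (f q)) < r \<and> \<epsilon> \<in> {0<..1}"
      by eventually_elim simp
    \<comment> \<open>The index is fixed before \<open>x\<close> moves: \<open>w e\<close> is
      uniformly close to \<open>f\<close> on \<open>K\<close> and maps \<open>q\<close> near
      \<open>f q\<close>.\<close>
    then obtain e where e: "(SUP p\<in>K. riem_dist Y h (w e p) (f p)) < ennreal (m * r)"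
        "w e q \<in> W" "dist (\<psi> (w e q)) (\<psi> (f q)) < r" "e \<in> {0<..1}"
      using eventually_happens'[OF trivial_limit_at_right_real[of "0::real"]] by blast
    define G where "G = W \<inter> \<psi> -` ball (\<psi> (f q)) r"
    have "openin (mtop Y) G"
      unfolding G_def by (rule openin_chart_vimage[OF cY subsetD[OF cY W] open_ball])
    then have "openin (mtop X) {p \<in> topspace (mtop X). w e p \<in> G}"
      by (rule openin_continuous_map_preimage[OF w[OF e(4)]])
    moreover have "q \<in> {p \<in> topspace (mtop X). w e p \<in> G}"
      using x e by (auto simp: G_def limitin_def dist_commute)
    ultimately have "\<forall>\<^sub>F \<epsilon> in F. x \<epsilon> \<in> {p \<in> topspace (mtop X). w e p \<in> G}"
      using x unfolding limitin_def by blast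
    moreover have "\<forall>\<^sub>F \<epsilon> in F. x \<epsilon> \<in> V \<and> dist (\<phi> (x \<epsilon>)) (\<phi> q) < R"
      using x R(1) unfolding limitin_coordinates[OF X c q] by blast
    ultimately show ?thesis
    proof eventually_elim
      case (elim \<epsilon>)
      then have "x \<epsilon> \<in> K" by (auto simp: K_def dist_commute)
      then have "riem_dist Y h (w e (x \<epsilon>)) (f (x \<epsilon>)) \<le> (SUP p\<in>K. riem_dist Y h (w e p) (f p))"
        by (rule SUP_upper)
      then have "riem_dist Y h (w e (x \<epsilon>)) (f (x \<epsilon>)) < ennreal (m * r)" using e(1) by (rule order_le_less_trans)
      moreover have "w e (x \<epsilon>) \<in> W \<and> dist (\<psi> (w e (x \<epsilon>))) (\<psi> (f q)) < r"
        using elim by (simp add: G_def dist_commute)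
      ultimately show ?case using m(2)[of "w e (x \<epsilon>)" "f (x \<epsilon>)"] r(3) by auto
    qed
  qed
  then show ?thesis unfolding limitin_coordinates[OF cY W yW] by blast
qed

section \<open>Generalized flows\<close>

lemma time_slice_representative:
  assumes "w \<in> time_slice X \<Phi> t"
  obtains v where "v \<in> \<Phi>" "((\<lambda>\<epsilon> x. v \<epsilon> (t, x)), w) \<in> map_eqv X X"
  using assms unfolding time_slice_def by blast

lemma compactin_slice:
  fixes s :: "'s::real_normed_vector"
  assumes "X \<subseteq> charts X" "compactin (mtop X) K"
  shows "compactin (mtop (prod_atlas (open_atlas UNIV) X)) (Pair s ` K)"
  using image_compactin[OF assms(2) continuous_map_slice[OF assms(1)]] .

lemma time_slice_limitin:
  fixes X :: "('a, 'e::{real_inner,heine_borel}) atlas"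
  assumes man: "smooth_manifold X" and \<Phi>: "\<Phi> \<in> gen_maps (R_times X) X" "u \<in> \<Phi>"
    and w: "w \<in> time_slice X \<Phi> t"
    and K: "compactin (mtop X) K" "\<forall>\<^sub>F \<epsilon> in at_right 0. x \<epsilon> \<in> K"
  shows "limitin (mtop X) (\<lambda>\<epsilon>. w \<epsilon> (x \<epsilon>)) q (at_right 0) \<longleftrightarrow>
         limitin (mtop X) (\<lambda>\<epsilon>. u \<epsilon> (t, x \<epsilon>)) q (at_right 0)"
proof -
  have X: "X \<subseteq> charts X" using man by (rule smooth_manifold_charts)
  obtain v where v: "v \<in> \<Phi>" "((\<lambda>\<epsilon> x. v \<epsilon> (t, x)), w) \<in> map_eqv X X"
    by (rule time_slice_representative[OF w])
  have "\<forall>\<^sub>F \<epsilon> in at_right 0. (t, x \<epsilon>) \<in> Pair t ` K" using K(2) by eventually_elim simp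
  from gen_maps_limitin[OF man \<Phi> v(1) compactin_slice[OF X K(1)] this]
  show ?thesis using unif_close_limitin[OF man map_eqv_unif_close[OF v(2)] K] by simp
qed

text \<open>The group law is known for one particular \<open>u\<close>, which need not yield the
  given slice representatives. At the fixed point \<open>((s, t), p)\<close> both sides of the law
  have the same limit; then the outer \<open>u\<close> is exchanged for \<open>w\<close> at the
  moving point \<open>u \<epsilon> (t, p)\<close>.\<close>

lemma generalized_flow_limitin:
  fixes X :: "('a, 'e::{real_inner,heine_borel}) atlas"
  assumes man: "smooth_manifold X" and flow: "generalized_flow X \<Xi> \<Phi>" and p: "p \<in> carrier X"
    and w: "w \<in> time_slice X \<Phi> s" "w' \<in> time_slice X \<Phi> t" "w'' \<in> time_slice X \<Phi> (s + t)"
    and q: "limitin (mtop X) (\<lambda>\<epsilon>. w' \<epsilon> p) q (at_right 0)"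
    and y: "limitin (mtop X) (\<lambda>\<epsilon>. w'' \<epsilon> p) y (at_right 0)"
  obtains u where "u \<in> \<Phi>" "limitin (mtop X) (\<lambda>\<epsilon>. u \<epsilon> (t, p)) q (at_right 0)"
    "limitin (mtop X) (\<lambda>\<epsilon>. w \<epsilon> (u \<epsilon> (t, p))) y (at_right 0)"
proof -
  have X: "X \<subseteq> charts X" using man by (rule smooth_manifold_charts)
  obtain u where \<Phi>: "\<Phi> \<in> gen_maps (R_times X) X" and u: "u \<in> \<Phi>"
    and grp: "((\<lambda>\<epsilon> ((t, s), x). u \<epsilon> (t + s, x)), (\<lambda>\<epsilon> ((t, s), x). u \<epsilon> (t, u \<epsilon> (s, x))))
          \<in> map_eqv (R2_times X) X"
    using flow unfolding generalized_flow_def by blast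
  have pK: "compactin (mtop X) {p}" "\<forall>\<^sub>F \<epsilon> in at_right (0::real). p \<in> {p}"
    using p by (simp_all add: topspace_mtop[OF X])
  have uq: "limitin (mtop X) (\<lambda>\<epsilon>. u \<epsilon> (t, p)) q (at_right 0)"
    using time_slice_limitin[OF man \<Phi> u w(2) pK] q by simp
  have "limitin (mtop X) (\<lambda>\<epsilon>. u \<epsilon> (s + t, p)) y (at_right 0)"
    using time_slice_limitin[OF man \<Phi> u w(3) pK] y by simp
  moreover have "compactin (mtop (R2_times X)) {((s, t), p)}"
    using compactin_slice[OF X pK(1), of "(s, t)"] by simp
  ultimately have "limitin (mtop X) (\<lambda>\<epsilon>. u \<epsilon> (s, u \<epsilon> (t, p))) y (at_right 0)"
    using unif_close_limitin[OF man map_eqv_unif_close[OF grp], of "{((s, t), p)}" "\<lambda>_. ((s, t), p)"] by simp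
  moreover obtain K where "compactin (mtop X) K" "\<forall>\<^sub>F \<epsilon> in at_right 0. u \<epsilon> (t, p) \<in> K"
    by (rule limitin_eventually_compact[OF X uq])
  ultimately have "limitin (mtop X) (\<lambda>\<epsilon>. w \<epsilon> (u \<epsilon> (t, p))) y (at_right 0)"
    using time_slice_limitin[OF man \<Phi> u w(1)] by simp
  then show ?thesis using that u uq by blast
qed

text \<open>Rates are transported from \<open>w\<close> through the slice of \<open>v\<close> and
  the common partner \<open>v0\<close> to \<open>u\<close>. Each link requires the limits of both of
  its nets beforehand.\<close>

lemma time_slice_rapid:
  fixes X :: "('a, 'e::{real_inner,heine_borel}) atlas"
  assumes man: "smooth_manifold X" and \<Phi>: "\<Phi> \<in> gen_maps (R_times X) X" "u \<in> \<Phi>"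
    and w: "w \<in> time_slice X \<Phi> t" and p: "p \<in> carrier X" and c: "(V, \<phi>) \<in> X" "q \<in> V"
    and lim: "limitin (mtop X) (\<lambda>\<epsilon>. w \<epsilon> p) q (at_right 0)"
    and rapid: "rapidly_near \<phi> (\<lambda>\<epsilon>. w \<epsilon> p) q"
  shows "rapidly_near \<phi> (\<lambda>\<epsilon>. u \<epsilon> (t, p)) q"
proof -
  have X: "X \<subseteq> charts X" using man by (rule smooth_manifold_charts)
  obtain v where v: "v \<in> \<Phi>" "((\<lambda>\<epsilon> x. v \<epsilon> (t, x)), w) \<in> map_eqv X X"
    by (rule time_slice_representative[OF w])
  obtain v0 where v0: "(v0, u) \<in> map_eqv (R_times X) X" "(v0, v) \<in> map_eqv (R_times X) X"
    by (rule gen_maps_representatives[OF \<Phi> v(1)])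
  obtain Z \<zeta> where Z: "(Z, \<zeta>) \<in> X" "p \<in> Z" using p by (rule carrier_in_atlas)
  have chart: "(UNIV \<times> Z, map_prod (\<lambda>x. x) \<zeta>) \<in> charts (R_times X)" "(t, p) \<in> UNIV \<times> Z"
    "(t, p) \<in> topspace (mtop (R_times X))"
    using prod_open_atlas_chart[OF X Z(1)] Z p by (auto simp: topspace_prod_open_atlas[OF X])
  have pK: "compactin (mtop X) {p}" "\<forall>\<^sub>F \<epsilon> in at_right (0::real). p \<in> {p}"
    using p by (simp_all add: topspace_mtop[OF X])
  have tpK: "compactin (mtop (R_times X)) {(t, p)}" "\<forall>\<^sub>F \<epsilon> in at_right (0::real). (t, p) \<in> {(t, p)}"
    using chart by simp_all
  have limv: "limitin (mtop X) (\<lambda>\<epsilon>. v \<epsilon> (t, p)) q (at_right 0)"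
    using time_slice_limitin[OF man \<Phi>(1) v(1) w pK] lim by simp
  have limu: "limitin (mtop X) (\<lambda>\<epsilon>. u \<epsilon> (t, p)) q (at_right 0)"
    using time_slice_limitin[OF man \<Phi> w pK] lim by simp
  have limv0: "limitin (mtop X) (\<lambda>\<epsilon>. v0 \<epsilon> (t, p)) q (at_right 0)"
    using unif_close_limitin[OF man map_eqv_unif_close[OF v0(1)] tpK] limu by simp
  have "rapidly_near \<phi> (\<lambda>\<epsilon>. v \<epsilon> (t, p)) q"
    using map_eqv_rapid[OF X v(2) subsetD[OF X Z(1)] Z(2) _ c limv lim] rapid p
    by (simp add: topspace_mtop[OF X])
  then have "rapidly_near \<phi> (\<lambda>\<epsilon>. v0 \<epsilon> (t, p)) q"
    using map_eqv_rapid[OF X v0(2) chart c limv0 limv] by simp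
  then show ?thesis
    using map_eqv_rapid[OF X v0(1) chart c limv0 limu] by simp
qed

section \<open>The flow property as uniqueness of limits\<close>

theorem flow_property_fast_assoc:
  fixes X :: "('a, 'e::{real_inner,heine_borel}) atlas"
  assumes man: "smooth_manifold X" and \<Psi>: "\<Psi> \<in> UNIV \<times> carrier X \<rightarrow> carrier X"
    and flow: "generalized_flow X \<Xi> \<Phi>"
    and fast: "\<And>t. fast_assoc X X (time_slice X \<Phi> t) (\<lambda>p. \<Psi> (t, p))"
  shows "flow_property X \<Psi>"
  unfolding flow_property_def
proof (intro allI ballI)
  fix s t p assume p: "p \<in> carrier X"
  have X: "X \<subseteq> charts X" using man by (rule smooth_manifold_charts)
  have \<Psi>c: "\<Psi> (r, z) \<in> carrier X" if "z \<in> carrier X" for r z using \<Psi> that by auto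
  \<comment> \<open>Each time \<open>r\<close> comes with its own representative and metric. The
    metric is eliminated here; the representative at time \<open>s\<close> is evaluated at
    \<open>\<Psi> (t, p)\<close>, those at times \<open>t\<close> and \<open>s + t\<close> at
    \<open>p\<close>.\<close>
  have ex: "\<exists>w\<in>time_slice X \<Phi> r. \<forall>z\<in>carrier X. limitin (mtop X) (\<lambda>\<epsilon>. w \<epsilon> z) (\<Psi> (r, z)) (at_right 0) \<and>
      (\<forall>(V, \<phi>)\<in>X. \<Psi> (r, z) \<in> V \<longrightarrow> rapidly_near \<phi> (\<lambda>\<epsilon>. w \<epsilon> z) (\<Psi> (r, z)))" for r
  proof -
    obtain w h where w: "w \<in> time_slice X \<Phi> r" and h: "riemannian_metric X h"
      and d: "\<And>z m::nat. z \<in> carrier X \<Longrightarrow>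
        unif_bigO (\<lambda>_. {z}) (\<lambda>\<epsilon> q. riem_dist X h (w \<epsilon> q) (\<Psi> (r, q))) (real m)"
      using fast[of r] unfolding fast_assoc_def by blast
    have d': "\<exists>C. \<forall>\<^sub>F \<epsilon> in at_right 0. riem_dist X h (w \<epsilon> z) (\<Psi> (r, z)) \<le> ennreal (C * \<epsilon> powr real m)"
      if "z \<in> carrier X" for z and m :: nat
      using d[OF that, of m] by (simp add: unif_bigO_def)
    show ?thesis
      using w rapid_riem_dist[OF man h \<Psi>c d'] by (intro bexI[of _ w]) auto
  qed
  obtain w where w: "w \<in> time_slice X \<Phi> s"
    "limitin (mtop X) (\<lambda>\<epsilon>. w \<epsilon> (\<Psi> (t, p))) (\<Psi> (s, \<Psi> (t, p))) (at_right 0)"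
    using ex[of s] \<Psi>c[OF p] by blast
  obtain V \<phi> where c: "(V, \<phi>) \<in> X" "\<Psi> (t, p) \<in> V" using \<Psi>c[OF p] by (rule carrier_in_atlas)
  obtain w' where w': "w' \<in> time_slice X \<Phi> t"
    "limitin (mtop X) (\<lambda>\<epsilon>. w' \<epsilon> p) (\<Psi> (t, p)) (at_right 0)" "rapidly_near \<phi> (\<lambda>\<epsilon>. w' \<epsilon> p) (\<Psi> (t, p))"
    using ex[of t] p c by blast
  obtain w'' where w'': "w'' \<in> time_slice X \<Phi> (s + t)"
    "limitin (mtop X) (\<lambda>\<epsilon>. w'' \<epsilon> p) (\<Psi> (s + t, p)) (at_right 0)"
    using ex[of "s + t"] p by blast
  obtain u where u: "u \<in> \<Phi>" "limitin (mtop X) (\<lambda>\<epsilon>. u \<epsilon> (t, p)) (\<Psi> (t, p)) (at_right 0)"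
    "limitin (mtop X) (\<lambda>\<epsilon>. w \<epsilon> (u \<epsilon> (t, p))) (\<Psi> (s + t, p)) (at_right 0)"
    by (rule generalized_flow_limitin[OF man flow p w(1) w'(1) w''(1) w'(2) w''(2)])
  have "\<Phi> \<in> gen_maps (R_times X) X" using flow by (simp add: generalized_flow_def)
  then have rapid: "rapidly_near \<phi> (\<lambda>\<epsilon>. u \<epsilon> (t, p)) (\<Psi> (t, p))"
    using time_slice_rapid[OF man _ u(1) w'(1) p c w'(2,3)] by simp
  have "w \<in> mod_maps X X"
    using time_slice_representative[OF w(1)] by (auto simp: map_eqv_def)
  from mod_maps_rapid_limitin[OF X man this c u(2) rapid w(2)]
  have "limitin (mtop X) (\<lambda>\<epsilon>. w \<epsilon> (u \<epsilon> (t, p))) (\<Psi> (s, \<Psi> (t, p))) (at_right 0)" .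
  then show "\<Psi> (s + t, p) = \<Psi> (s, \<Psi> (t, p))"
    using limitin_Hausdorff_unique[OF u(3)] man by (simp add: smooth_manifold_def)
qed

theorem flow_property_zero_assoc:
  fixes X :: "('a, 'e::{real_inner,heine_borel}) atlas"
  assumes man: "smooth_manifold X" and \<Psi>: "\<Psi> \<in> UNIV \<times> carrier X \<rightarrow> carrier X"
    and flow: "generalized_flow X \<Xi> \<Phi>"
    and zero: "\<And>t. zero_assoc X X (time_slice X \<Phi> t) (\<lambda>p. \<Psi> (t, p))"
  shows "flow_property X \<Psi>"
  unfolding flow_property_def
proof (intro allI ballI)
  fix s t p assume p: "p \<in> carrier X"
  have X: "X \<subseteq> charts X" using man by (rule smooth_manifold_charts)
  have \<Psi>c: "\<Psi> (r, z) \<in> carrier X" if "z \<in> carrier X" for r z using \<Psi> that by auto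
  have ex: "\<exists>w\<in>time_slice X \<Phi> r. unif_close X X w (\<lambda>_ p. \<Psi> (r, p))" for r
    using zero[of r] unfolding zero_assoc_def by blast
  have lim: "limitin (mtop X) (\<lambda>\<epsilon>. w \<epsilon> p) (\<Psi> (r, p)) (at_right 0)"
    if "unif_close X X w (\<lambda>_ p. \<Psi> (r, p))" for w r
    using unif_close_limitin[OF man that, of "{p}" "\<lambda>_. p"] p \<Psi>c[OF p]
    by (simp add: topspace_mtop[OF X])
  obtain w where w: "w \<in> time_slice X \<Phi> s" "unif_close X X w (\<lambda>_ p. \<Psi> (s, p))"
    using ex by blast
  obtain w' where w': "w' \<in> time_slice X \<Phi> t" "unif_close X X w' (\<lambda>_ p. \<Psi> (t, p))"
    using ex by blast
  obtain w'' where w'': "w'' \<in> time_slice X \<Phi> (s + t)" "unif_close X X w'' (\<lambda>_ p. \<Psi> (s + t, p))"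
    using ex by blast
  obtain u where u: "u \<in> \<Phi>" "limitin (mtop X) (\<lambda>\<epsilon>. u \<epsilon> (t, p)) (\<Psi> (t, p)) (at_right 0)"
    "limitin (mtop X) (\<lambda>\<epsilon>. w \<epsilon> (u \<epsilon> (t, p))) (\<Psi> (s + t, p)) (at_right 0)"
    by (rule generalized_flow_limitin[OF man flow p w(1) w'(1) w''(1) lim[OF w'(2)] lim[OF w''(2)]])
  obtain K where K: "compactin (mtop X) K" "\<forall>\<^sub>F \<epsilon> in at_right 0. u \<epsilon> (t, p) \<in> K"
    by (rule limitin_eventually_compact[OF X u(2)])
  \<comment> \<open>Uniform closeness on \<open>K\<close> permits replacing \<open>w\<close> by
    \<open>\<Psi>\<close> at time \<open>s\<close> along the moving points, so both limits concern
    the net \<open>\<Psi> (s, u \<epsilon> (t, p))\<close>.\<close>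
  have y: "limitin (mtop X) (\<lambda>\<epsilon>. \<Psi> (s, u \<epsilon> (t, p))) (\<Psi> (s + t, p)) (at_right 0)"
    using unif_close_limitin[OF man w(2) K] u(3) by simp
  have "w \<in> mod_maps X X"
    using time_slice_representative[OF w(1)] by (auto simp: map_eqv_def)
  then have cont: "continuous_map (mtop X) (mtop X) (w \<epsilon>)" if "\<epsilon> \<in> {0<..1}" for \<epsilon>
    using that by (simp add: mod_maps_def smooth_map_def)
  have "limitin (mtop X) (\<lambda>\<epsilon>. \<Psi> (s, u \<epsilon> (t, p))) (\<Psi> (s, \<Psi> (t, p))) (at_right 0)"
    by (rule unif_close_const_limitin[OF X man cont w(2) _ u(2)]) (use \<Psi>c p in auto)
  then show "\<Psi> (s + t, p) = \<Psi> (s, \<Psi> (t, p))"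
    using limitin_Hausdorff_unique[OF y] man by (simp add: smooth_manifold_def)
qed

theorem theorem6p3:
  fixes X :: "('a, 'e::{real_inner,heine_borel}) atlas"
    and \<xi> :: "(real \<Rightarrow> ('a, 'e) field) set"
    and \<Psi> :: "real \<times> 'a \<Rightarrow> 'a"
  assumes "smooth_manifold X"
    and "\<xi> \<in> gen_fields X"
    and "\<Psi> \<in> UNIV \<times> carrier X \<rightarrow> carrier X"
  shows "(\<forall>h \<Phi>. riemannian_metric X h \<and> complete_metric X h \<and> globally_bounded X h \<xi> \<and>
            (\<forall>P. diff_op X 1 P \<longrightarrow>
               locally_Linf_log X (field_apply X P \<xi>) \<and> locally_bounded X (field_apply X P \<xi>)) \<and>
            generalized_flow X \<xi> \<Phi> \<and>
            (\<forall>t. fast_assoc X X (time_slice X \<Phi> t) (\<lambda>p. \<Psi> (t, p))) \<longrightarrow>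
            flow_property X \<Psi>) \<and>
         (\<forall>\<Phi>. G_complete X \<xi> \<and> generalized_flow X \<xi> \<Phi> \<and>
            (\<forall>t. zero_assoc X X (time_slice X \<Phi> t) (\<lambda>p. \<Psi> (t, p))) \<longrightarrow>
            flow_property X \<Psi>)"
  using flow_property_fast_assoc[OF assms(1,3)] flow_property_zero_assoc[OF assms(1,3)] by blast

end
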